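(* Let $\Gamma\subset\mathrm{PSL}_2(\mathbb R)$ be any cocompact Fuchsian group (any genus $g\ge0$, any signature) and $V$ any quasi-vertex operator algebra. For $k=2n\ge2$, the map $$\pi_n:M_k(V,\Gamma)\to M_0(\Gamma)\otimes V_n=V_n,\qquad f\mapsto f_n,$$ sending $f$ to its component $f_n$ of conformal degree $n$, has image exactly $$\mathrm{im}(\pi_n)=QP_n(V).$$
   Context: QVOA: a quasi-vertex operator algebra is a $\mathbb Z$-graded vertex algebra $V=\bigoplus_n V_n$ (vertex operators $Y$, vacuum $\mathbf 1$) with $\dim V_n<\infty$ and $V_n=0$ for $n\ll0$, together with operators $L(-1),L(0),L(1)$ satisfying $[L(m),L(n)]=(m-n)L(m+n)$, where $L(-1)$ is the canonical derivation, $L(0)$ acts on $V_n$ as $n$ and $[L(1),Y(u,z)]=Y((L(1)+2zL(0)+z^2L(-1))u,z)$. $F_NV=\bigoplus_{n\le N}V_n$. $QP_n(V):=\ker(L(1):V_n\to V_{n-1})$ is the space of quasi-primary states of weight $n$. Elements of $\Gamma$ are lifted to $\mathrm{SL}_2(\mathbb R)$ (full preimage). For $\gamma=\begin{pmatrix}a&b\\c&d\end{pmatrix}$: $j(\gamma,\tau)=c\tau+d$, $f|_k\gamma(\tau)=j(\gamma,\tau)^{-k}f(\gamma\tau)$, $K(\gamma,\tau)=e^{-c\,j(\gamma,\tau)L(1)}j(\gamma,\tau)^{-2L(0)}$, $f\Vert_k\gamma(\tau)=j(\gamma,\tau)^{-k}K(\gamma,\tau)^{-1}f(\gamma\tau)$.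 For cocompact $\Gamma$ (no cusps): $M_k(\Gamma)$ is the space of holomorphic $f:\mathbb H\to\mathbb C$ with $f|_k\gamma=f$ for all $\gamma\in\Gamma$ (so $M_0(\Gamma)=\mathbb C$); $M_k(V,\Gamma)$ is the space of holomorphic $f:\mathbb H\to F_NV$ (some $N$) with $f\Vert_k\gamma=f$ for all $\gamma\in\Gamma$ and with $f(\tau_i)$ fixed by $j(\gamma_i,\tau_i)^kK(\gamma_i,\tau_i)$ at every elliptic point $\tau_i$ with stabilizer generator $\gamma_i$. Every $f\in M_{2n}(V,\Gamma)$ takes values in $F_nV$; write $f=\sum_{i\le n}f_i$ with $f_i:\mathbb H\to V_i$; then $f_n\in M_0(\Gamma)\otimes V_n$ is a constant vector. *)

theory Defs
  imports
    "HOL-Complex_Analysis.Complex_Analysis"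
    "HOL-Algebra.Coset"
    "HOL-Algebra.Generated_Groups"
    "HOL-Library.Groups_Big_Fun"
begin

section \<open>Quasi-vertex operator algebras\<close>

text \<open>
  The underlying complex vector space is a whole type \<open>'v\<close> with scalar
  multiplication \<open>scl\<close>.  \<open>mode V u n\<close> is the endomorphism \<open>u(n)\<close> in
  \<open>Y(u,z) = (\<Sum>n. u(n) z^(-n-1))\<close>.  Only \<open>Lop V (-1)\<close>, \<open>Lop V 0\<close> and
  \<open>Lop V 1\<close> are meaningful.
\<close>

record 'v qvoa_data =
  scl  :: "complex \<Rightarrow> 'v \<Rightarrow> 'v"
  wt   :: "int \<Rightarrow> 'v set"
  mode :: "'v \<Rightarrow> int \<Rightarrow> 'v \<Rightarrow> 'v"
  vac  :: "'v"
  Lop  :: "int \<Rightarrow> 'v \<Rightarrow> 'v"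

abbreviation linear_op :: "('v::ab_group_add) qvoa_data \<Rightarrow> ('v \<Rightarrow> 'v) \<Rightarrow> bool" where
  "linear_op V f \<equiv> Vector_Spaces.linear (scl V) (scl V) f"

text \<open>\<open>Sum_any\<close> sums over the support of its argument and is \<open>0\<close> if that support
  is infinite; by truncation all sums in the Borcherds identity have finite support.\<close>

locale vertex_algebra =
  fixes V :: "('v::ab_group_add) qvoa_data"
  assumes vector_space: "vector_space (scl V)"
    and mode_linear_left: "linear_op V (\<lambda>u. mode V u n v)"
    and mode_linear_right: "linear_op V (mode V u n)"
    and truncation: "\<exists>N. \<forall>n\<ge>N. mode V u n v = 0"
    and vacuum: "mode V (vac V) n v = (if n = -1 then v else 0)"
    and creation: "mode V u (-1) (vac V) = u" "n \<ge> 0 \<Longrightarrow> mode V u n (vac V) = 0"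
    and borcherds:
      "Sum_any (\<lambda>i::nat. scl V (of_int p gchoose i)
          (mode V (mode V u (r + int i) v) (p + q - int i) w)) =
       Sum_any (\<lambda>i::nat. scl V ((-1) ^ i * (of_int r gchoose i))
          (mode V u (p + r - int i) (mode V v (q + int i) w)
           - scl V ((-1) powi r) (mode V v (q + r - int i) (mode V u (p + int i) w))))"

definition is_decomposition :: "('v::ab_group_add) qvoa_data \<Rightarrow> 'v \<Rightarrow> (int \<Rightarrow> 'v) \<Rightarrow> bool" where
  "is_decomposition V v x \<longleftrightarrow>
     (\<forall>n. x n \<in> wt V n) \<and> finite {n. x n \<noteq> 0} \<and> v = Sum_any x"

locale graded_vertex_algebra = vertex_algebra V
  for V :: "('v::ab_group_add) qvoa_data" +
  assumes wt_subspace: "module.subspace (scl V) (wt V n)"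
    and direct_sum: "\<exists>!x. is_decomposition V v x"
    and vac_wt: "vac V \<in> wt V 0"
    and mode_wt: "\<lbrakk>u \<in> wt V m; v \<in> wt V r\<rbrakk> \<Longrightarrow> mode V u n v \<in> wt V (m + r - n - 1)"

text \<open>The \<open>L\<close> relation for \<open>m = n = 1\<close> or \<open>m = n = -1\<close> has coefficient \<open>0\<close>, so no
  condition is put on \<open>Lop V 2\<close>, \<open>Lop V (-2)\<close>.  The last axiom is the coefficient
  of \<open>z^(-n-1)\<close> in \<open>[L(1),Y(u,z)] = Y((L(1) + 2zL(0) + z^2L(-1))u,z)\<close>.\<close>

locale quasi_vertex_operator_algebra = graded_vertex_algebra V
  for V :: "('v::ab_group_add) qvoa_data" +
  assumes wt_finite_dim: "\<exists>B. finite B \<and> wt V n = module.span (scl V) B"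
    and wt_bounded_below: "\<exists>N. \<forall>n<N. wt V n = {0}"
    and Lop_linear: "m \<in> {-1, 0, 1} \<Longrightarrow> linear_op V (Lop V m)"
    and Lop_commutator: "\<lbrakk>m \<in> {-1, 0, 1}; n \<in> {-1, 0, 1}\<rbrakk> \<Longrightarrow>
        Lop V m (Lop V n v) - Lop V n (Lop V m v) = scl V (of_int (m - n)) (Lop V (m + n) v)"
    and Lm1_canonical: "Lop V (-1) v = mode V v (-2) (vac V)"
    and L0_wt: "v \<in> wt V n \<Longrightarrow> Lop V 0 v = scl V (of_int n) v"
    and L1_covariance:
      "Lop V 1 (mode V u n v) - mode V u n (Lop V 1 v) =
         mode V (Lop V 1 u) n v + scl V 2 (mode V (Lop V 0 u) (n + 1) v)
           + mode V (Lop V (-1) u) (n + 2) v"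

definition component :: "('v::ab_group_add) qvoa_data \<Rightarrow> int \<Rightarrow> 'v \<Rightarrow> 'v" where
  "component V n v = (THE x. is_decomposition V v x) n"

definition filt :: "('v::ab_group_add) qvoa_data \<Rightarrow> int \<Rightarrow> 'v set" where
  "filt V N = {v. \<forall>n>N. component V n v = 0}"

definition QP :: "('v::ab_group_add) qvoa_data \<Rightarrow> int \<Rightarrow> 'v set" where
  "QP V n = {v \<in> wt V n. Lop V 1 v = 0}"

text \<open>\<open>exp_L1 V x\<close> is \<open>e^(x L(1))\<close> (a finite sum on each vector, as \<open>L(1)\<close> lowers
  the grading) and \<open>pow_L0 V x e\<close> is \<open>x^(e L(0))\<close>.\<close>

definition exp_L1 :: "('v::ab_group_add) qvoa_data \<Rightarrow> complex \<Rightarrow> 'v \<Rightarrow> 'v" where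
  "exp_L1 V x v = Sum_any (\<lambda>m::nat. scl V (x ^ m / fact m) ((Lop V 1 ^^ m) v))"

definition pow_L0 :: "('v::ab_group_add) qvoa_data \<Rightarrow> complex \<Rightarrow> int \<Rightarrow> 'v \<Rightarrow> 'v" where
  "pow_L0 V x e v = Sum_any (\<lambda>n::int. scl V (x powi (e * n)) (component V n v))"


section \<open>Cocompact Fuchsian groups\<close>

definition upper_half_plane :: "complex set" where
  "upper_half_plane = {\<tau>. Im \<tau> > 0}"

definition SL2R :: "(real^2^2) monoid" where
  "SL2R = \<lparr>carrier = {A. det A = 1}, mult = (**), one = mat 1\<rparr>"

definition PSL2R :: "(real^2^2) set monoid" where
  "PSL2R = SL2R Mod {mat 1, - mat 1}"

lemma group_SL2R: "group SL2R"
proof (rule groupI)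
  fix A assume A: "A \<in> carrier SL2R"
  then have "invertible A" by (simp add: SL2R_def invertible_det_nz)
  then obtain B where B: "B ** A = mat 1" by (auto simp: invertible_def)
  then have "det B * det A = 1" by (metis det_I det_mul)
  then have "det B = 1" using A by (simp add: SL2R_def)
  then show "\<exists>B\<in>carrier SL2R. B \<otimes>\<^bsub>SL2R\<^esub> A = \<one>\<^bsub>SL2R\<^esub>"
    using B by (auto simp: SL2R_def)
qed (auto simp: SL2R_def det_mul matrix_mul_assoc)

lemma normal_center_SL2R: "{mat 1, - mat 1} \<lhd> SL2R"
proof -
  interpret group SL2R by (rule group_SL2R)
  have m: "- A = - mat 1 ** A" "- A = A ** - mat 1" for A :: "real^2^2"
    by (simp_all add: matrix_matrix_mult_def mat_def vec_eq_iff sum_2 forall_2)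
  have d: "det (- mat 1 :: real^2^2) = 1" by (simp add: det_2 mat_def)
  have i: "inv\<^bsub>SL2R\<^esub> (- mat 1) = - mat 1"
    by (rule inv_equality) (use d m(1)[of "- mat 1"] in \<open>auto simp: SL2R_def\<close>)
  have "subgroup {mat 1, - mat 1} SL2R"
    using d i m(1)[of "- mat 1"] inv_one
    by (auto intro!: subgroup.intro simp: SL2R_def)
  then show ?thesis
  proof (rule normalI, intro ballI)
    fix A assume "A \<in> carrier SL2R"
    show "{mat 1, - mat 1} #>\<^bsub>SL2R\<^esub> A = A <#\<^bsub>SL2R\<^esub> {mat 1, - mat 1}"
      using m[of A] by (auto simp: r_coset_def l_coset_def SL2R_def)
  qed
qed

definition aut_factor :: "real^2^2 \<Rightarrow> complex \<Rightarrow> complex" where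
  "aut_factor \<gamma> \<tau> = of_real (\<gamma>$2$1) * \<tau> + of_real (\<gamma>$2$2)"

definition moebius :: "real^2^2 \<Rightarrow> complex \<Rightarrow> complex" where
  "moebius \<gamma> \<tau> = (of_real (\<gamma>$1$1) * \<tau> + of_real (\<gamma>$1$2)) / aut_factor \<gamma> \<tau>"

text \<open>An element of \<open>PSL2R\<close> is a coset \<open>{A, -A}\<close>, so for a subset \<open>\<Gamma>\<close> of its carrier
  the union \<open>\<Union>\<Gamma>\<close> is the full preimage in \<open>SL2R\<close>.  As the projection is a two-sheeted
  covering, \<open>\<Gamma>\<close> is discrete iff \<open>\<Union>\<Gamma>\<close> is discrete.\<close>

definition fuchsian :: "(real^2^2) set set \<Rightarrow> bool" where
  "fuchsian \<Gamma> \<longleftrightarrow> subgroup \<Gamma> PSL2R \<and> discrete (\<Union>\<Gamma>)"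

definition orbit :: "(real^2^2) set set \<Rightarrow> complex \<Rightarrow> complex set" where
  "orbit \<Gamma> \<tau> = (\<lambda>\<gamma>. moebius \<gamma> \<tau>) ` \<Union>\<Gamma>"

definition orbit_space :: "(real^2^2) set set \<Rightarrow> complex set topology" where
  "orbit_space \<Gamma> = topology (\<lambda>U. U \<subseteq> orbit \<Gamma> ` upper_half_plane \<and>
      open {\<tau> \<in> upper_half_plane. orbit \<Gamma> \<tau> \<in> U})"

lemma openin_orbit_space:
  "openin (orbit_space \<Gamma>) U \<longleftrightarrow> U \<subseteq> orbit \<Gamma> ` upper_half_plane \<and>
      open {\<tau> \<in> upper_half_plane. orbit \<Gamma> \<tau> \<in> U}"
proof -
  have "istopology (\<lambda>U. U \<subseteq> orbit \<Gamma> ` upper_half_plane \<and>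
      open {\<tau> \<in> upper_half_plane. orbit \<Gamma> \<tau> \<in> U})" (is "istopology ?P")
    unfolding istopology_def
  proof (intro conjI allI impI)
    fix S T assume "?P S" "?P T"
    moreover have "{\<tau> \<in> upper_half_plane. orbit \<Gamma> \<tau> \<in> S \<inter> T} =
        {\<tau> \<in> upper_half_plane. orbit \<Gamma> \<tau> \<in> S} \<inter> {\<tau> \<in> upper_half_plane. orbit \<Gamma> \<tau> \<in> T}"
      by auto
    ultimately show "S \<inter> T \<subseteq> orbit \<Gamma> ` upper_half_plane"
      "open {\<tau> \<in> upper_half_plane. orbit \<Gamma> \<tau> \<in> S \<inter> T}"
      by (auto intro: open_Int)
  next
    fix \<K> assume "\<forall>K\<in>\<K>. ?P K"
    moreover have "{\<tau> \<in> upper_half_plane. orbit \<Gamma> \<tau> \<in> \<Union>\<K>} =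
        (\<Union>K\<in>\<K>. {\<tau> \<in> upper_half_plane. orbit \<Gamma> \<tau> \<in> K})"
      by auto
    ultimately show "\<Union>\<K> \<subseteq> orbit \<Gamma> ` upper_half_plane"
      "open {\<tau> \<in> upper_half_plane. orbit \<Gamma> \<tau> \<in> \<Union>\<K>}"
      by (auto intro: open_UN)
  qed
  then show ?thesis by (simp add: orbit_space_def topology_inverse')
qed

definition cocompact_fuchsian :: "(real^2^2) set set \<Rightarrow> bool" where
  "cocompact_fuchsian \<Gamma> \<longleftrightarrow> fuchsian \<Gamma> \<and> compact_space (orbit_space \<Gamma>)"

definition stabilizer_PSL :: "(real^2^2) set set \<Rightarrow> complex \<Rightarrow> (real^2^2) set set" where
  "stabilizer_PSL \<Gamma> \<tau> = {x \<in> \<Gamma>. \<forall>\<gamma>\<in>x. moebius \<gamma> \<tau> = \<tau>}"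

definition elliptic_point :: "(real^2^2) set set \<Rightarrow> complex \<Rightarrow> bool" where
  "elliptic_point \<Gamma> \<tau> \<longleftrightarrow> \<tau> \<in> upper_half_plane \<and> stabilizer_PSL \<Gamma> \<tau> \<noteq> {\<one>\<^bsub>PSL2R\<^esub>}"


section \<open>Modular forms with values in a quasi-vertex operator algebra\<close>

definition Kop :: "('v::ab_group_add) qvoa_data \<Rightarrow> real^2^2 \<Rightarrow> complex \<Rightarrow> 'v \<Rightarrow> 'v" where
  "Kop V \<gamma> \<tau> v =
     exp_L1 V (- (of_real (\<gamma>$2$1) * aut_factor \<gamma> \<tau>)) (pow_L0 V (aut_factor \<gamma> \<tau>) (-2) v)"

definition slash :: "('v::ab_group_add) qvoa_data \<Rightarrow> int \<Rightarrow> (complex \<Rightarrow> 'v) \<Rightarrow> real^2^2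
    \<Rightarrow> complex \<Rightarrow> 'v" where
  "slash V k f \<gamma> \<tau> = scl V (aut_factor \<gamma> \<tau> powi (-k)) (inv_into UNIV (Kop V \<gamma> \<tau>) (f (moebius \<gamma> \<tau>)))"

text \<open>Holomorphy of a map into the finite-dimensional space \<open>F_N V\<close>: all its linear
  coordinates are holomorphic.\<close>

definition holomorphic_filt ::
    "('v::ab_group_add) qvoa_data \<Rightarrow> int \<Rightarrow> (complex \<Rightarrow> 'v) \<Rightarrow> bool" where
  "holomorphic_filt V N f \<longleftrightarrow>
     f \<in> upper_half_plane \<rightarrow>\<^sub>E filt V N \<and>
     (\<forall>\<phi> :: 'v \<Rightarrow> complex. Vector_Spaces.linear (scl V) (*) \<phi> \<longrightarrow>
        (\<lambda>\<tau>. \<phi> (f \<tau>)) holomorphic_on upper_half_plane)"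

text \<open>Functions on the upper half-plane are extensional, so that equality of elements
  is equality of functions on the half-plane.\<close>

definition modular_forms ::
    "('v::ab_group_add) qvoa_data \<Rightarrow> (real^2^2) set set \<Rightarrow> int \<Rightarrow> (complex \<Rightarrow> 'v) set" where
  "modular_forms V \<Gamma> k = {f.
     (\<exists>N. holomorphic_filt V N f) \<and>
     (\<forall>\<gamma>\<in>\<Union>\<Gamma>. \<forall>\<tau>\<in>upper_half_plane. slash V k f \<gamma> \<tau> = f \<tau>) \<and>
     (\<forall>\<tau>. elliptic_point \<Gamma> \<tau> \<longrightarrow>
        (\<forall>x\<in>stabilizer_PSL \<Gamma> \<tau>. generate PSL2R {x} = stabilizer_PSL \<Gamma> \<tau> \<longrightarrow>
          (\<forall>\<gamma>\<in>x. scl V (aut_factor \<gamma> \<tau> powi k) (Kop V \<gamma> \<tau> (f \<tau>)) = f \<tau>)))}"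

definition component_map ::
    "('v::ab_group_add) qvoa_data \<Rightarrow> int \<Rightarrow> (complex \<Rightarrow> 'v) \<Rightarrow> complex \<Rightarrow> 'v" where
  "component_map V n f = (\<lambda>\<tau>\<in>upper_half_plane. component V n (f \<tau>))"

text \<open>The identification of a vector \<open>v\<close> with the constant function \<open>1 \<otimes> v\<close> on the
  half-plane.\<close>

definition const_form :: "'v \<Rightarrow> complex \<Rightarrow> 'v" where
  "const_form v = (\<lambda>\<tau>\<in>upper_half_plane. v)"

end

theory Submission
  imports Defs
begin

text \<open>
Write \<open>j = c\<tau> + d\<close> and \<open>y = Im \<tau>\<close>, and let \<open>f\<close> be a \<open>V\<close>-valued modular form of weight \<open>2n\<close>. The condition
\<open>f(\<gamma>\<tau>) = j^(2n) K(\<gamma>,\<tau>) f(\<tau>)\<close> is triangular for the grading, because \<open>L(1)\<close> lowers weights. If \<open>f\<close>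
takes values in \<open>F_N V\<close>, its top component is an ordinary automorphic form of weight \<open>2n - 2N\<close>.

For \<open>N > n\<close> this weight is negative, and for \<open>N = n\<close> it is zero. On a compact quotient the invariant function
\<open>|h| y^(-m)\<close> of a form \<open>h\<close> of weight \<open>-2m\<close> attains its maximum at some \<open>\<tau>0\<close>. Comparing \<open>h\<close> with
\<open>(\<tau> - cnj \<tau>0)^(2m)\<close> turns this into a maximum of the modulus of a holomorphic function, so \<open>h\<close> is constant, and zero if
\<open>m > 0\<close> (\<open>nonpositive_weight_constant\<close>). Hence \<open>f\<close> takes values in \<open>F_n V\<close> and its component of
weight \<open>n\<close> is a constant vector \<open>v\<close>.

The component below it obeys \<open>f_(n-1)(\<gamma>\<tau>) = j^2 f_(n-1)(\<tau>) - c j L(1)v\<close>. If \<open>L(1)v\<close> were not zero, a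
linear functional that takes the value \<open>1\<close> on it would produce a holomorphic function \<open>g\<close> with
\<open>g(\<gamma>\<tau>) = j^2 g(\<tau>) - c j\<close>, a relative of the Eisenstein series \<open>E_2\<close>. Such a \<open>g\<close> does not exist
(\<open>no_quasimodular_form\<close>): the function \<open>E = g + i/(2y)\<close> has weight two, so
\<open>E d\<tau>\<close> is an invariant form whose differential is a nonzero multiple of the hyperbolic area form, and integration
over the compact quotient contradicts Stokes' theorem. The integral is taken without fundamental domains. A compactly supported
\<open>\<phi>\<close> whose translates add up to \<open>1\<close> serves as a weight on the half-plane, and \<open>\<integral> E \<partial>\<phi>\<close> (with \<open>\<partial>\<close> the
antiholomorphic derivative) is computed twice: integration by parts gives a negative multiple of the area
\<open>\<integral> \<phi>/y^2\<close>, while unfolding against the translates of \<open>\<phi>\<close> gives zero. So \<open>L(1)v = 0\<close>.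

Conversely, \<open>K(\<gamma>,\<tau>)\<close> multiplies a quasi-primary vector of weight \<open>n\<close> by \<open>j^(-2n)\<close>, so the
constant function with this value is a modular form of weight \<open>2n\<close>.
\<close>

no_notation fps_nth (infixl \<open>$\<close> 75)

section \<open>Moebius transformations\<close>

lemma aut_factor_nonzero:
  assumes "det \<gamma> = 1" "Im \<tau> > 0"
  shows "aut_factor \<gamma> \<tau> \<noteq> 0"
proof
  assume "aut_factor \<gamma> \<tau> = 0"
  then have "\<gamma>$2$1 * Re \<tau> + \<gamma>$2$2 = 0" "\<gamma>$2$1 * Im \<tau> = 0"
    by (auto simp: aut_factor_def complex_eq_iff)
  then show False using assms by (auto simp: det_2)
qed

lemma moebius_mult:
  assumes "det B = 1" "Im \<tau> > 0"
  shows "aut_factor (A ** B) \<tau> = aut_factor A (moebius B \<tau>) * aut_factor B \<tau>"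
    and "moebius (A ** B) \<tau> = moebius A (moebius B \<tau>)"
proof -
  define j where "j = aut_factor B \<tau>"
  have j0: "j \<noteq> 0" using aut_factor_nonzero[OF assms] by (simp add: j_def)
  define p where "p = of_real (B$1$1) * \<tau> + of_real (B$1$2)"
  have jd: "j = of_real (B$2$1) * \<tau> + of_real (B$2$2)" by (simp add: j_def aut_factor_def)
  have m: "moebius B \<tau> = p / j" by (simp add: moebius_def p_def j_def)
  have lin: "(of_real a * (p / j) + of_real b) * j = of_real a * p + of_real b * j" for a b
    using j0 by (simp add: field_simps)
  show 1: "aut_factor (A ** B) \<tau> = aut_factor A (moebius B \<tau>) * aut_factor B \<tau>"
    unfolding m aut_factor_def[of A] j_def[symmetric] lin
    by (simp add: aut_factor_def matrix_matrix_mult_def sum_2 jd p_def algebra_simps)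
  have n: "of_real ((A ** B)$1$1) * \<tau> + of_real ((A ** B)$1$2) = (of_real (A$1$1) * (p / j) + of_real (A$1$2)) * j"
    unfolding lin by (simp add: matrix_matrix_mult_def sum_2 jd p_def algebra_simps)
  show "moebius (A ** B) \<tau> = moebius A (moebius B \<tau>)"
    unfolding moebius_def[of "A ** B"] 1 n
    using j0 by (simp add: m moebius_def[of A] j_def[symmetric])
qed

text \<open>
The imaginary part of \<open>(a\<tau> + b) cnj (c\<tau> + d)\<close> is \<open>det \<gamma> * Im \<tau>\<close>.
\<close>

lemma Im_moebius:
  assumes "det \<gamma> = 1" "Im \<tau> > 0"
  shows "Im (moebius \<gamma> \<tau>) = Im \<tau> / (norm (aut_factor \<gamma> \<tau>))\<^sup>2"
proof -
  have "Im ((of_real (\<gamma>$1$1) * \<tau> + of_real (\<gamma>$1$2)) * cnj (aut_factor \<gamma> \<tau>)) = Im \<tau> * det \<gamma>"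
    by (simp add: aut_factor_def det_2 algebra_simps)
  moreover have "moebius \<gamma> \<tau> = ((of_real (\<gamma>$1$1) * \<tau> + of_real (\<gamma>$1$2)) * cnj (aut_factor \<gamma> \<tau>)) /
      of_real ((norm (aut_factor \<gamma> \<tau>))\<^sup>2)"
    unfolding moebius_def by (subst complex_div_cnj) simp
  ultimately show ?thesis
    using assms by (simp only: Im_divide_of_real mult_1_right)
qed

lemma Im_moebius_pos:
  assumes "det \<gamma> = 1" "Im \<tau> > 0"
  shows "Im (moebius \<gamma> \<tau>) > 0"
  using Im_moebius[OF assms] aut_factor_nonzero[OF assms] assms by simp

lemma moebius_has_field_derivative:
  assumes "det \<gamma> = 1" "Im \<tau> > 0"
  shows "(moebius \<gamma> has_field_derivative inverse ((aut_factor \<gamma> \<tau>)\<^sup>2)) (at \<tau>)"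
proof -
  have "(\<gamma>$1$1) * (\<gamma>$2$2) - (\<gamma>$1$2) * (\<gamma>$2$1) = 1" using assms by (simp add: det_2)
  then have d: "complex_of_real (\<gamma>$1$1) * of_real (\<gamma>$2$2) - of_real (\<gamma>$1$2) * of_real (\<gamma>$2$1) = 1"
    by (metis of_real_1 of_real_diff of_real_mult)
  have nz: "of_real (\<gamma>$2$1) * \<tau> + of_real (\<gamma>$2$2) \<noteq> 0"
    using aut_factor_nonzero[OF assms] by (simp add: aut_factor_def)
  have n: "of_real (\<gamma>$1$1) * (of_real (\<gamma>$2$1) * \<tau> + of_real (\<gamma>$2$2)) -
      (of_real (\<gamma>$1$1) * \<tau> + of_real (\<gamma>$1$2)) * of_real (\<gamma>$2$1) = (1::complex)"
    using d by (simp add: algebra_simps)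
  have "((\<lambda>\<tau>. (of_real (\<gamma>$1$1) * \<tau> + of_real (\<gamma>$1$2)) / (of_real (\<gamma>$2$1) * \<tau> + of_real (\<gamma>$2$2)))
      has_field_derivative ((of_real (\<gamma>$1$1) * (of_real (\<gamma>$2$1) * \<tau> + of_real (\<gamma>$2$2)) -
        (of_real (\<gamma>$1$1) * \<tau> + of_real (\<gamma>$1$2)) * of_real (\<gamma>$2$1)) /
        ((of_real (\<gamma>$2$1) * \<tau> + of_real (\<gamma>$2$2)) * (of_real (\<gamma>$2$1) * \<tau> + of_real (\<gamma>$2$2))))) (at \<tau>)"
    by (rule DERIV_divide, use nz in \<open>auto intro!: derivative_eq_intros\<close>)
  then show ?thesis
    unfolding n by (simp add: moebius_def[abs_def] aut_factor_def power2_eq_square divide_inverse)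
qed

lemma moebius_inverse:
  assumes "det A = 1" "det B = 1" "A ** B = mat 1" "Im \<tau> > 0"
  shows "moebius A (moebius B \<tau>) = \<tau>"
    and "aut_factor A (moebius B \<tau>) * aut_factor B \<tau> = 1"
proof -
  show "moebius A (moebius B \<tau>) = \<tau>"
    unfolding moebius_mult(2)[OF assms(2,4), symmetric] assms(3)
    by (simp add: moebius_def aut_factor_def mat_def)
  show "aut_factor A (moebius B \<tau>) * aut_factor B \<tau> = 1"
    unfolding moebius_mult(1)[OF assms(2,4), symmetric] assms(3)
    by (simp add: aut_factor_def mat_def)
qed

text \<open>
The adjugate matrix. It is the inverse on \<open>SL(2,R)\<close>, with entries visibly controlled by those of the matrix, and
is an involution on all matrices.
\<close>

definition adj2 :: "real^2^2 \<Rightarrow> real^2^2" where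
  "adj2 A = vector [vector [A$2$2, - A$1$2], vector [- A$2$1, A$1$1]]"

lemma adj2_nth [simp]:
  "adj2 A $ 1 $ 1 = A$2$2" "adj2 A $ 1 $ 2 = - A$1$2" "adj2 A $ 2 $ 1 = - A$2$1" "adj2 A $ 2 $ 2 = A$1$1"
  by (simp_all add: adj2_def)

lemma adj2_adj2 [simp]: "adj2 (adj2 A) = A"
  by (simp add: vec_eq_iff forall_2)

lemma det_adj2 [simp]: "det (adj2 A) = det A"
  by (simp add: det_2)

lemma adj2_mult:
  assumes "det A = 1"
  shows "A ** adj2 A = mat 1" "adj2 A ** A = mat 1"
  using assms by (simp_all add: vec_eq_iff forall_2 matrix_matrix_mult_def sum_2 mat_def det_2 algebra_simps)

lemma open_half_plane: "open {\<tau>. Im \<tau> > 0}"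
  by (intro open_Collect_less continuous_intros)

lemma continuous_on_moebius: "det \<gamma> = 1 \<Longrightarrow> continuous_on {\<tau>. Im \<tau> > 0} (moebius \<gamma>)"
  by (rule DERIV_continuous_on, rule has_field_derivative_at_within, rule moebius_has_field_derivative) auto

section \<open>Integration over the plane\<close>

text \<open>
Jacobian determinants belong to maps of \<open>real^2\<close>, holomorphic functions live on \<open>complex\<close>; this pair of mutually inverse linear maps passes between them.
\<close>

definition of_plane :: "real^2 \<Rightarrow> complex" where
  "of_plane v = Complex (v$1) (v$2)"

definition to_plane :: "complex \<Rightarrow> real^2" where
  "to_plane z = (\<chi> i. if i = 1 then Re z else Im z)"

lemma to_plane_nth [simp]: "to_plane z $ 1 = Re z" "to_plane z $ 2 = Im z"
  by (simp_all add: to_plane_def)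

lemma to_plane_0 [simp]: "to_plane 0 = 0"
  by (simp add: to_plane_def vec_eq_iff)

lemma of_plane_sel [simp]: "Re (of_plane v) = v $ 1" "Im (of_plane v) = v $ 2"
  by (simp_all add: of_plane_def)

lemma of_plane_to_plane [simp]: "of_plane (to_plane z) = z"
  by (simp add: complex_eq_iff)

lemma to_plane_of_plane [simp]: "to_plane (of_plane v) = v"
  by (simp add: vec_eq_iff forall_2)

lemma linear_of_plane: "linear of_plane"
  by (rule linearI) (simp_all add: complex_eq_iff)

lemma bounded_linear_of_plane: "bounded_linear of_plane"
  using linear_of_plane by (simp add: linear_conv_bounded_linear)

lemma linear_to_plane: "linear to_plane"
  by (rule linearI) (simp_all add: vec_eq_iff forall_2)

lemma bounded_linear_to_plane: "bounded_linear to_plane"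
  using linear_to_plane by (simp add: linear_conv_bounded_linear)

lemmas of_plane_add = linear_add[OF linear_of_plane]

lemma continuous_on_of_plane [continuous_intros]: "continuous_on S of_plane"
  by (rule linear_continuous_on[OF bounded_linear_of_plane])

lemma continuous_on_to_plane [continuous_intros]: "continuous_on S to_plane"
  by (rule linear_continuous_on[OF bounded_linear_to_plane])

definition plane_integral :: "(complex \<Rightarrow> complex) \<Rightarrow> complex" where
  "plane_integral F = integral UNIV (\<lambda>v. F (of_plane v))"

lemma lborel_integrable_compact_support:
  fixes F :: "complex \<Rightarrow> 'b::{banach, second_countable_topology}"
  assumes "continuous_on UNIV F" "compact K" "\<And>z. z \<notin> K \<Longrightarrow> F z = 0"
  shows "integrable lborel (\<lambda>v. F (of_plane v))"
proof -
  have "compact (to_plane ` K)"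
    by (intro compact_continuous_image continuous_intros assms)
  moreover have "continuous_on (to_plane ` K) (\<lambda>v. F (of_plane v))"
    by (rule continuous_on_compose2[OF assms(1)]) (auto intro: continuous_intros)
  ultimately have "integrable lborel (\<lambda>v. indicator (to_plane ` K) v *\<^sub>R F (of_plane v))"
    by (rule borel_integrable_compact)
  moreover have "indicator (to_plane ` K) v *\<^sub>R F (of_plane v) = F (of_plane v)" for v
    using assms(3)[of "of_plane v"] to_plane_of_plane[of v]
    by (cases "of_plane v \<in> K") (auto simp: indicator_def image_iff)
  ultimately show ?thesis by simp
qed

lemma plane_integrable:
  fixes F :: "complex \<Rightarrow> complex"
  assumes "continuous_on UNIV F" "compact K" "\<And>z. z \<notin> K \<Longrightarrow> F z = 0"
  shows "(\<lambda>v. F (of_plane v)) integrable_on UNIV"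
  by (rule integrable_on_lborel[OF lborel_integrable_compact_support[OF assms]])

text \<open>
The integral of a difference quotient \<open>(F(z + s h) - F(z)) / s\<close> is zero because Lebesgue measure is translation
invariant; the quotients are bounded by the maximum of the directional derivative, so dominated convergence applies as
\<open>s\<close> tends to zero.
\<close>

lemma plane_integral_derivative_eq_0:
  fixes F :: "complex \<Rightarrow> complex"
  assumes der: "\<And>z. (F has_derivative F' z) (at z)"
    and cont: "\<And>h. continuous_on UNIV (\<lambda>z. F' z h)"
    and K: "compact K" "\<And>z. z \<notin> K \<Longrightarrow> F z = 0"
  shows "plane_integral (\<lambda>z. F' z h) = 0"
proof -
  have cF: "continuous_on UNIV F"
    using der by (meson continuous_at_imp_continuous_on has_derivative_continuous)
  define s where "s n = inverse (real (Suc n))" for n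
  have s0: "s n > 0" "s n \<le> 1" for n by (auto simp: s_def field_simps)
  have slim: "s \<longlonglongrightarrow> 0" unfolding s_def by (rule LIMSEQ_inverse_real_of_nat)
  \<comment> \<open>All difference quotients live on one compact set, and are bounded there.\<close>
  define K1 where "K1 = {x + y |x y. x \<in> K \<and> y \<in> cball 0 (norm h)}"
  have cK1: "compact K1" unfolding K1_def by (intro compact_sums K compact_cball)
  have K1I: "z \<in> K1" if "z + t *\<^sub>R h \<in> K" "0 \<le> t" "t \<le> 1" for z t
  proof -
    have "z = (z + t *\<^sub>R h) + (- (t *\<^sub>R h))" by simp
    moreover have "norm (- (t *\<^sub>R h)) \<le> norm h"
      using that by (simp add: mult_left_le_one_le)
    ultimately show ?thesis unfolding K1_def using that(1)
      by (metis (mono_tags, lifting) mem_Collect_eq mem_cball_0)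
  qed
  have F'0: "F' z h = 0" if "z \<notin> K" for z
  proof -
    have "eventually (\<lambda>w. w \<in> - K) (nhds z)"
      using K(1) that by (intro eventually_nhds_in_open) (auto intro: compact_imp_closed simp: open_Compl)
    then have ev: "eventually (\<lambda>w. F w = 0) (nhds z)"
      by eventually_elim (use K in auto)
    have "((\<lambda>_. 0) has_derivative F' z) (at z)"
      by (rule has_derivative_transform_eventually[OF der])
         (use ev K that in \<open>auto simp: eventually_at_filter elim: eventually_mono\<close>)
    then have "F' z = (\<lambda>_. 0)"
      by (rule has_derivative_unique) (rule has_derivative_const)
    then show ?thesis by simp
  qed
  have "bounded (range (\<lambda>z. F' z h))"
  proof -
    have "bounded ((\<lambda>z. F' z h) ` K)"
      by (intro compact_imp_bounded compact_continuous_image K continuous_on_subset[OF cont]) auto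
    moreover have "range (\<lambda>z. F' z h) \<subseteq> insert 0 ((\<lambda>z. F' z h) ` K)" using F'0 by auto
    ultimately show ?thesis by (meson bounded_insert bounded_subset)
  qed
  then obtain B where B: "\<And>z. norm (F' z h) \<le> B" by (auto simp: bounded_iff)
  define Q where "Q n z = (F (z + s n *\<^sub>R h) - F z) /\<^sub>R s n" for n z
  have Qbound: "norm (Q n z) \<le> B" for n z
  proof -
    have d: "((\<lambda>t. F (z + t *\<^sub>R h)) has_derivative (\<lambda>u. F' (z + t *\<^sub>R h) (u *\<^sub>R h))) (at t within {0..s n})" for t
      by (rule has_derivative_compose[OF _ der]) (auto intro!: derivative_eq_intros)
    have "norm (F (z + s n *\<^sub>R h) - F (z + 0 *\<^sub>R h)) \<le> B * norm (s n - 0)"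
    proof (rule differentiable_bound[OF convex_real_interval(5) d])
      fix t show "onorm (\<lambda>u. F' (z + t *\<^sub>R h) (u *\<^sub>R h)) \<le> B"
      proof (rule onorm_le)
        fix u :: real
        have "F' (z + t *\<^sub>R h) (u *\<^sub>R h) = u *\<^sub>R F' (z + t *\<^sub>R h) h"
          using has_derivative_linear[OF der] by (rule linear_scale)
        then show "norm (F' (z + t *\<^sub>R h) (u *\<^sub>R h)) \<le> B * norm u"
          using mult_right_mono[OF B[of "z + t *\<^sub>R h"], of "\<bar>u\<bar>"] by (simp add: mult.commute)
      qed
    qed (use s0[of n] in auto)
    then show ?thesis using s0(1)[of n] by (simp add: Q_def divide_simps mult.commute)
  qed
  have Qlim: "(\<lambda>n. Q n z) \<longlonglongrightarrow> F' z h" for z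
  proof -
    have "((\<lambda>t. F (z + t *\<^sub>R h)) has_derivative (\<lambda>u. F' (z + 0 *\<^sub>R h) (u *\<^sub>R h))) (at 0)"
      by (rule has_derivative_compose[OF _ der]) (auto intro!: derivative_eq_intros)
    moreover have "(\<lambda>u. F' z (u *\<^sub>R h)) = (\<lambda>u. u *\<^sub>R F' z h)"
      using has_derivative_linear[OF der] by (auto simp: linear_scale)
    ultimately have "((\<lambda>t. norm (F (z + t *\<^sub>R h) - F z - t *\<^sub>R F' z h) / norm t) \<longlongrightarrow> 0) (at 0)"
      by (simp add: has_derivative_at)
    then have "((\<lambda>t. norm ((F (z + t *\<^sub>R h) - F z) /\<^sub>R t - F' z h)) \<longlongrightarrow> 0) (at 0)"
    proof (rule Lim_transform_within[OF _ zero_less_one])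
      fix t :: real assume "0 < dist t 0"
      then have "t \<noteq> 0" by simp
      then have "(F (z + t *\<^sub>R h) - F z) /\<^sub>R t - F' z h = (F (z + t *\<^sub>R h) - F z - t *\<^sub>R F' z h) /\<^sub>R t"
        by (simp add: algebra_simps)
      then show "norm (F (z + t *\<^sub>R h) - F z - t *\<^sub>R F' z h) / norm t =
        norm ((F (z + t *\<^sub>R h) - F z) /\<^sub>R t - F' z h)"
        by (simp add: divide_inverse mult.commute)
    qed
    then have "((\<lambda>t. (F (z + t *\<^sub>R h) - F z) /\<^sub>R t) \<longlongrightarrow> F' z h) (at 0)"
      by (simp add: tendsto_norm_zero_iff LIM_zero_iff)
    moreover have "filterlim s (at 0) sequentially"
      using slim s0(1) by (auto simp: filterlim_at intro!: always_eventually) (metis less_irrefl)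
    ultimately show ?thesis unfolding Q_def by (rule filterlim_compose)
  qed
  have intF: "integrable lborel (\<lambda>v. F (of_plane v))"
    by (rule lborel_integrable_compact_support[OF cF K])
  have Q0: "(\<integral>v. Q n (of_plane v) \<partial>lborel) = 0" for n
  proof -
    have tr: "integrable lborel (\<lambda>v. F (of_plane v + s n *\<^sub>R h)) \<and>
       (\<integral>v. F (of_plane v + s n *\<^sub>R h) \<partial>lborel) = (\<integral>v. F (of_plane v) \<partial>lborel)"
    proof -
      have eq: "F (of_plane (to_plane (s n *\<^sub>R h) + v)) = F (of_plane v + s n *\<^sub>R h)" for v
        by (simp add: of_plane_add add.commute)
      have m: "(\<lambda>v. F (of_plane v)) \<in> borel_measurable borel"
        using borel_measurable_integrable[OF intF] by simp
      have "integrable (distr lborel borel ((+) (to_plane (s n *\<^sub>R h)))) (\<lambda>v. F (of_plane v))"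
        unfolding lborel_distr_plus by (rule intF)
      then have "integrable lborel (\<lambda>v. F (of_plane (to_plane (s n *\<^sub>R h) + v)))"
        using m by (subst (asm) integrable_distr_eq) auto
      moreover have "(\<integral>v. F (of_plane v) \<partial>distr lborel borel ((+) (to_plane (s n *\<^sub>R h)))) =
          (\<integral>v. F (of_plane (to_plane (s n *\<^sub>R h) + v)) \<partial>lborel)"
        using m by (intro integral_distr) auto
      ultimately show ?thesis unfolding eq lborel_distr_plus by simp
    qed
    then show ?thesis unfolding Q_def using intF by simp
  qed
  have cont': "continuous_on UNIV (\<lambda>v. Q n (of_plane v))" for n
    unfolding Q_def by (intro continuous_intros continuous_on_compose2[OF cF]) auto
  have "(\<lambda>n. \<integral>v. Q n (of_plane v) \<partial>lborel) \<longlonglongrightarrow> (\<integral>v. F' (of_plane v) h \<partial>lborel)"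
  proof (rule integral_dominated_convergence)
    show "(\<lambda>v. F' (of_plane v) h) \<in> borel_measurable lborel"
      by (simp, intro borel_measurable_continuous_onI continuous_on_compose2[OF cont]) (auto intro: continuous_intros)
    show "(\<lambda>v. Q n (of_plane v)) \<in> borel_measurable lborel" for n
      using cont' by (simp add: borel_measurable_continuous_onI)
    have "compact (to_plane ` K1)"
      by (intro compact_continuous_image continuous_intros cK1)
    then show "integrable lborel (\<lambda>v. indicator (to_plane ` K1) v *\<^sub>R B)"
      by (intro borel_integrable_compact) auto
    show "AE v in lborel. (\<lambda>n. Q n (of_plane v)) \<longlonglongrightarrow> F' (of_plane v) h"
      using Qlim by simp
    show "AE v in lborel. norm (Q n (of_plane v)) \<le> indicator (to_plane ` K1) v *\<^sub>R B" for n
    proof (rule AE_I2)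
      fix v
      show "norm (Q n (of_plane v)) \<le> indicator (to_plane ` K1) v *\<^sub>R B"
      proof (cases "of_plane v \<in> K1")
        case True
        then have "v \<in> to_plane ` K1" by (metis image_eqI to_plane_of_plane)
        then show ?thesis using Qbound by simp
      next
        case False
        then have "of_plane v \<notin> K" "of_plane v + s n *\<^sub>R h \<notin> K"
          using K1I[of "of_plane v" 0] K1I[of "of_plane v" "s n"] s0[of n] by auto
        then have "Q n (of_plane v) = 0" by (simp add: Q_def K)
        moreover have "0 \<le> B" using B[of 0] norm_ge_zero order_trans by blast
        ultimately show ?thesis by (simp add: indicator_def)
      qed
    qed
  qed
  then have "(\<integral>v. F' (of_plane v) h \<partial>lborel) = 0"
    using Q0 by (simp add: LIMSEQ_const_iff)
  moreover have "integrable lborel (\<lambda>v. F' (of_plane v) h)"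
    by (rule lborel_integrable_compact_support[OF cont K(1) F'0])
  ultimately show ?thesis
    unfolding plane_integral_def by (simp add: integral_lborel)
qed

text \<open>
The hyperbolic area is invariant: a Moebius transformation has complex derivative \<open>1 / j^2\<close>, so its real
Jacobian determinant is \<open>1 / |j|^4\<close>.
\<close>

lemma plane_integral_moebius:
  fixes F :: "complex \<Rightarrow> complex"
  assumes \<gamma>: "det \<gamma> = 1"
    and cont: "continuous_on UNIV F"
    and K: "compact K" "K \<subseteq> upper_half_plane" "\<And>z. z \<notin> K \<Longrightarrow> F z = 0"
  shows "plane_integral (\<lambda>\<tau>. if Im \<tau> > 0 then F (moebius \<gamma> \<tau>) / of_real (norm (aut_factor \<gamma> \<tau>) ^ 4) else 0)
       = plane_integral F"
proof -
  define S where "S = {v::real^2. v $ 2 > 0}"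
  define g where "g v = to_plane (moebius \<gamma> (of_plane v))" for v
  define g' where "g' v h = to_plane (inverse ((aut_factor \<gamma> (of_plane v))\<^sup>2) * of_plane h)" for v h
  define f where "f v = to_plane (F (of_plane v))" for v
  define \<delta> where "\<delta> = adj2 \<gamma>"
  have \<delta>: "det \<delta> = 1" "\<gamma> ** \<delta> = mat 1" "\<delta> ** \<gamma> = mat 1"
    using \<gamma> adj2_mult[OF \<gamma>] by (simp_all add: \<delta>_def)
  have openS: "open S" unfolding S_def by (intro open_Collect_less continuous_intros)
  have SI: "v \<in> S \<longleftrightarrow> Im (of_plane v) > 0" for v by (simp add: S_def)
  have gS: "g ` S = S"
  proof
    show "g ` S \<subseteq> S" using Im_moebius_pos[OF \<gamma>] by (auto simp: g_def S_def)
    show "S \<subseteq> g ` S"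
    proof
      fix v assume v: "v \<in> S"
      have "v = g (to_plane (moebius \<delta> (of_plane v)))"
        using v moebius_inverse(1)[OF \<gamma> \<delta>(1,2)] by (simp add: g_def SI)
      moreover have "to_plane (moebius \<delta> (of_plane v)) \<in> S"
        using v Im_moebius_pos[OF \<delta>(1)] by (simp add: SI)
      ultimately show "v \<in> g ` S" by blast
    qed
  qed
  have inj: "inj_on g S"
  proof (rule inj_on_inverseI)
    fix v assume "v \<in> S"
    then show "to_plane (moebius \<delta> (of_plane (g v))) = v"
      using moebius_inverse(1)[OF \<delta>(1) \<gamma> \<delta>(3)] by (simp add: g_def SI)
  qed
  have der: "(g has_derivative g' v) (at v within S)" if "v \<in> S" for v
  proof -
    have "(moebius \<gamma> has_derivative (*) (inverse ((aut_factor \<gamma> (of_plane v))\<^sup>2))) (at (of_plane v))"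
      using moebius_has_field_derivative[OF \<gamma>] that by (simp add: SI has_field_derivative_def)
    then have "((\<lambda>v. moebius \<gamma> (of_plane v)) has_derivative
        (\<lambda>h. inverse ((aut_factor \<gamma> (of_plane v))\<^sup>2) * of_plane h)) (at v within S)"
      by (rule has_derivative_compose[OF bounded_linear_imp_has_derivative[OF bounded_linear_of_plane]])
    then show ?thesis unfolding g_def g'_def
      by (rule bounded_linear.has_derivative[OF bounded_linear_to_plane])
  qed
  have det: "\<bar>det (matrix (g' v))\<bar> = inverse (norm (aut_factor \<gamma> (of_plane v)) ^ 4)" for v
  proof -
    have "det (matrix (\<lambda>h. to_plane (w * of_plane h))) = (norm w)\<^sup>2" for w
      by (simp add: det_2 matrix_def axis_def cmod_power2) (simp add: power2_eq_square)
    then show ?thesis unfolding g'_def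
      by (simp add: norm_inverse norm_power power_inverse flip: power_mult)
  qed
  have fint: "integrable lborel f" unfolding f_def
    by (rule lborel_integrable_compact_support[OF _ K(1)])
       (auto intro!: continuous_on_compose2[OF continuous_on_to_plane[of UNIV] cont] simp: K(3))
  have f0: "f v = 0" if "v \<notin> S" for v
  proof -
    have "of_plane v \<notin> K" using that K(2) by (auto simp: SI upper_half_plane_def)
    then show ?thesis by (simp add: f_def K(3))
  qed
  have fabs: "f absolutely_integrable_on S"
  proof -
    have "integrable lebesgue f" using fint by (simp add: integrable_completion)
    moreover have "(\<lambda>v. indicat_real S v *\<^sub>R f v) = f" using f0 by (auto simp: indicator_def)
    ultimately show ?thesis by (simp add: set_integrable_def)
  qed
  have "integral S f = integral UNIV f"
    unfolding integral_restrict_UNIV[of S f, symmetric]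
    by (intro arg_cong[where f="integral UNIV"] ext) (use f0 in auto)
  also have "\<dots> = to_plane (plane_integral F)"
    unfolding f_def plane_integral_def
    by (rule integral_linear[OF plane_integrable[OF cont K(1,3)] bounded_linear_to_plane, unfolded o_def])
  finally have fI: "f absolutely_integrable_on (g ` S) \<and> integral (g ` S) f = to_plane (plane_integral F)"
    using fabs gS by simp
  define G where "G v = \<bar>det (matrix (g' v))\<bar> *\<^sub>R f (g v)" for v
  have G: "G absolutely_integrable_on S" "integral S G = to_plane (plane_integral F)"
    using iffD2[OF has_absolute_integral_change_of_variables[OF _ der inj] fI] openS
    by (auto simp: G_def[abs_def])
  have "of_plane (integral S G) = integral S (\<lambda>v. of_plane (G v))"
    by (rule integral_linear[OF set_lebesgue_integral_eq_integral(1)[OF G(1)] bounded_linear_of_plane, unfolded o_def, symmetric])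
  also have "\<dots> = integral UNIV (\<lambda>v. if v \<in> S then of_plane (G v) else 0)"
    by (rule integral_restrict_UNIV[symmetric])
  also have "\<dots> = integral UNIV (\<lambda>v. if Im (of_plane v) > 0
      then F (moebius \<gamma> (of_plane v)) / of_real (norm (aut_factor \<gamma> (of_plane v)) ^ 4) else 0)"
  proof (intro arg_cong[where f="integral UNIV"] ext)
    fix v
    have "of_plane (G v) = \<bar>det (matrix (g' v))\<bar> *\<^sub>R of_plane (f (g v))"
      unfolding G_def by (rule linear_scale[OF linear_of_plane])
    also have "\<dots> = F (moebius \<gamma> (of_plane v)) / of_real (norm (aut_factor \<gamma> (of_plane v)) ^ 4)"
      by (simp add: det f_def g_def scaleR_conv_of_real divide_inverse)
    finally show "(if v \<in> S then of_plane (G v) else 0) = (if Im (of_plane v) > 0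
      then F (moebius \<gamma> (of_plane v)) / of_real (norm (aut_factor \<gamma> (of_plane v)) ^ 4) else 0)"
      by (simp add: SI)
  qed
  finally show ?thesis by (simp add: G(2) plane_integral_def)
qed

section \<open>Continuously differentiable functions of a complex variable\<close>

text \<open>
Real differentiability with continuous directional derivatives. Derivatives are those of the full space, so the predicate is
meant for open sets \<open>U\<close>.
\<close>

definition C1_on :: "complex set \<Rightarrow> (complex \<Rightarrow> 'b::real_normed_vector) \<Rightarrow> bool" where
  "C1_on U f \<longleftrightarrow> (\<exists>f'. (\<forall>z\<in>U. (f has_derivative f' z) (at z)) \<and> (\<forall>h. continuous_on U (\<lambda>z. f' z h)))"

text \<open>
Twice the Wirtinger derivative in the direction of the conjugate variable.
\<close>

definition dbar :: "(complex \<Rightarrow> complex) \<Rightarrow> complex \<Rightarrow> complex" where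
  "dbar f z = frechet_derivative f (at z) 1 + \<i> * frechet_derivative f (at z) \<i>"

lemma C1_onI:
  assumes "\<And>z. z \<in> U \<Longrightarrow> (f has_derivative f' z) (at z)" "\<And>h. continuous_on U (\<lambda>z. f' z h)"
  shows "C1_on U f"
  using assms unfolding C1_on_def by blast

lemma C1_on_imp_continuous_on: "C1_on U f \<Longrightarrow> continuous_on U f"
  unfolding C1_on_def by (meson continuous_at_imp_continuous_on has_derivative_continuous)

lemma dbar_eq: "(f has_derivative f') (at z) \<Longrightarrow> dbar f z = f' 1 + \<i> * f' \<i>"
  unfolding dbar_def by (simp flip: frechet_derivative_at)

lemma C1_on_imp_continuous_on_dbar:
  assumes "C1_on U f"
  shows "continuous_on U (dbar f)"
proof -
  obtain f' where f': "\<And>z. z \<in> U \<Longrightarrow> (f has_derivative f' z) (at z)" "\<And>h. continuous_on U (\<lambda>z. f' z h)"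
    using assms unfolding C1_on_def by blast
  have "continuous_on U (\<lambda>z. f' z 1 + \<i> * f' z \<i>)" by (intro continuous_intros f')
  then show ?thesis by (rule continuous_on_eq) (simp add: dbar_eq[OF f'(1)])
qed

lemma C1_on_subset: "C1_on U f \<Longrightarrow> V \<subseteq> U \<Longrightarrow> C1_on V f"
  unfolding C1_on_def by (meson continuous_on_subset subsetD)

lemma C1_on_const [intro]: "C1_on U (\<lambda>_. c)"
  by (rule C1_onI[where f'="\<lambda>_ _. 0"]) auto

lemma C1_on_bounded_linear: "bounded_linear f \<Longrightarrow> C1_on U f"
  by (rule C1_onI[where f'="\<lambda>_. f"]) (auto intro: bounded_linear_imp_has_derivative)

lemma C1_on_bounded_linear_compose:
  assumes "bounded_linear L" "C1_on U f"
  shows "C1_on U (\<lambda>z. L (f z))"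
proof -
  obtain f' where f': "\<And>z. z \<in> U \<Longrightarrow> (f has_derivative f' z) (at z)" "\<And>h. continuous_on U (\<lambda>z. f' z h)"
    using assms(2) unfolding C1_on_def by blast
  show ?thesis
    by (rule C1_onI[where f'="\<lambda>z h. L (f' z h)"])
       (auto intro: bounded_linear.has_derivative[OF assms(1)] bounded_linear.continuous_on[OF assms(1)] f')
qed

lemma C1_on_add:
  assumes "C1_on U f" "C1_on U g"
  shows "C1_on U (\<lambda>z. f z + g z)"
proof -
  obtain f' g' where "\<And>z. z \<in> U \<Longrightarrow> (f has_derivative f' z) (at z)" "\<And>h. continuous_on U (\<lambda>z. f' z h)"
     "\<And>z. z \<in> U \<Longrightarrow> (g has_derivative g' z) (at z)" "\<And>h. continuous_on U (\<lambda>z. g' z h)"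
    using assms unfolding C1_on_def by blast
  then show ?thesis
    by (intro C1_onI[where f'="\<lambda>z h. f' z h + g' z h"]) (auto intro!: derivative_intros continuous_intros)
qed

lemma C1_on_sum:
  "(\<And>i. i \<in> I \<Longrightarrow> C1_on U (f i)) \<Longrightarrow> C1_on U (\<lambda>z. \<Sum>i\<in>I. f i z)"
  by (induction I rule: infinite_finite_induct) (auto intro: C1_on_add)

lemma C1_on_mult:
  fixes f g :: "complex \<Rightarrow> 'b::real_normed_algebra"
  assumes "C1_on U f" "C1_on U g"
  shows "C1_on U (\<lambda>z. f z * g z)"
proof -
  obtain f' g' where "\<And>z. z \<in> U \<Longrightarrow> (f has_derivative f' z) (at z)" "\<And>h. continuous_on U (\<lambda>z. f' z h)"
     "\<And>z. z \<in> U \<Longrightarrow> (g has_derivative g' z) (at z)" "\<And>h. continuous_on U (\<lambda>z. g' z h)"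
    using assms unfolding C1_on_def by blast
  then show ?thesis using assms
    by (intro C1_onI[where f'="\<lambda>z h. f z * g' z h + f' z h * g z"])
       (auto intro!: derivative_intros continuous_intros dest: C1_on_imp_continuous_on)
qed

lemma C1_on_inverse:
  fixes f :: "complex \<Rightarrow> 'b::real_normed_field"
  assumes "C1_on U f" "\<And>z. z \<in> U \<Longrightarrow> f z \<noteq> 0"
  shows "C1_on U (\<lambda>z. inverse (f z))"
proof -
  obtain f' where f': "\<And>z. z \<in> U \<Longrightarrow> (f has_derivative f' z) (at z)" "\<And>h. continuous_on U (\<lambda>z. f' z h)"
    using assms(1) unfolding C1_on_def by blast
  show ?thesis
    by (rule C1_onI[where f'="\<lambda>z h. - (inverse (f z) * f' z h * inverse (f z))"])
       (auto intro!: Deriv.has_derivative_inverse f' continuous_intros assms(2) C1_on_imp_continuous_on[OF assms(1)])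
qed

lemma C1_on_real_compose:
  fixes f :: "complex \<Rightarrow> real"
  assumes "C1_on U f" "\<And>t. (g has_real_derivative g' t) (at t)" "continuous_on UNIV g'"
  shows "C1_on U (\<lambda>z. g (f z))"
proof -
  obtain f' where f': "\<And>z. z \<in> U \<Longrightarrow> (f has_derivative f' z) (at z)" "\<And>h. continuous_on U (\<lambda>z. f' z h)"
    using assms(1) unfolding C1_on_def by blast
  show ?thesis
  proof (rule C1_onI[where f'="\<lambda>z h. g' (f z) * f' z h"])
    show "((\<lambda>z. g (f z)) has_derivative (\<lambda>h. g' (f z) * f' z h)) (at z)" if "z \<in> U" for z
      using has_derivative_compose[OF f'(1)[OF that] assms(2)[unfolded has_field_derivative_def]] .
    show "continuous_on U (\<lambda>z. g' (f z) * f' z h)" for h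
      by (intro continuous_intros f' continuous_on_compose2[OF assms(3)] C1_on_imp_continuous_on[OF assms(1)]) auto
  qed
qed

text \<open>
A real derivative at a complex point is determined by its values at \<open>1\<close> and \<open>\<i>\<close>; this reduces the
continuity of composed derivatives, and the behaviour of \<open>dbar\<close>, to two directions.
\<close>

lemma has_derivative_complex_expand:
  assumes "(f has_derivative f') (at (z::complex))"
  shows "f' w = Re w *\<^sub>R f' 1 + Im w *\<^sub>R f' \<i>"
proof -
  have "w = Re w *\<^sub>R 1 + Im w *\<^sub>R \<i>" by (simp add: complex_eq_iff)
  then have "f' w = f' (Re w *\<^sub>R 1 + Im w *\<^sub>R \<i>)" by simp
  then show ?thesis
    using has_derivative_linear[OF assms] by (simp only: linear_add linear_scale)
qed

lemma C1_on_holomorphic_compose: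
  assumes "C1_on V f" "open U" "m holomorphic_on U" "m ` U \<subseteq> V"
  shows "C1_on U (\<lambda>z. f (m z))"
proof -
  obtain f' where f': "\<And>z. z \<in> V \<Longrightarrow> (f has_derivative f' z) (at z)" "\<And>h. continuous_on V (\<lambda>z. f' z h)"
    using assms(1) unfolding C1_on_def by blast
  show ?thesis
  proof (rule C1_onI[where f'="\<lambda>z h. f' (m z) (deriv m z * h)"])
    fix z assume z: "z \<in> U"
    have "(m has_derivative (*) (deriv m z)) (at z)"
      using holomorphic_derivI[OF assms(3,2) z] by (simp add: has_field_derivative_def)
    then show "((\<lambda>z. f (m z)) has_derivative (\<lambda>h. f' (m z) (deriv m z * h))) (at z)"
      by (rule has_derivative_compose) (use f'(1) z assms(4) in auto)
  next
    fix h
    have c: "continuous_on U (\<lambda>z. f' (m z) w)" for w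
      by (rule continuous_on_compose2[OF f'(2)]) (use assms in \<open>auto intro: holomorphic_on_imp_continuous_on\<close>)
    have "continuous_on U (deriv m)"
      by (intro holomorphic_on_imp_continuous_on holomorphic_deriv assms)
    then have "continuous_on U (\<lambda>z. Re (deriv m z * h) *\<^sub>R f' (m z) 1 + Im (deriv m z * h) *\<^sub>R f' (m z) \<i>)"
      by (intro continuous_intros c)
    then show "continuous_on U (\<lambda>z. f' (m z) (deriv m z * h))"
    proof (rule continuous_on_eq)
      fix z assume "z \<in> U"
      then have "m z \<in> V" using assms(4) by blast
      then show "Re (deriv m z * h) *\<^sub>R f' (m z) 1 + Im (deriv m z * h) *\<^sub>R f' (m z) \<i> = f' (m z) (deriv m z * h)"
        using has_derivative_complex_expand[OF f'(1)] by metis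
    qed
  qed
qed

lemma C1_on_holomorphic: "open U \<Longrightarrow> f holomorphic_on U \<Longrightarrow> C1_on U f"
  using C1_on_holomorphic_compose[OF C1_on_bounded_linear[OF bounded_linear_ident, of UNIV]] by simp

lemma C1_on_cong:
  assumes "C1_on U f" "open U" "\<And>z. z \<in> U \<Longrightarrow> f z = g z"
  shows "C1_on U g"
proof -
  obtain f' where f': "\<And>z. z \<in> U \<Longrightarrow> (f has_derivative f' z) (at z)" "\<And>h. continuous_on U (\<lambda>z. f' z h)"
    using assms(1) unfolding C1_on_def by blast
  show ?thesis
    by (rule C1_onI[OF has_derivative_transform_within_open[OF f'(1)] f'(2)]) (use assms in auto)
qed

lemma C1_on_Un:
  assumes "C1_on U f" "C1_on V f" "open U" "open V"
  shows "C1_on (U \<union> V) f"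
proof -
  have fr: "(f has_derivative frechet_derivative f (at z)) (at z) \<and> (\<forall>h. continuous_on W (\<lambda>z. frechet_derivative f (at z) h))"
    if C1: "C1_on W f" and "z \<in> W" for z W
  proof -
    obtain f' where f': "\<And>z. z \<in> W \<Longrightarrow> (f has_derivative f' z) (at z)" "\<And>h. continuous_on W (\<lambda>z. f' z h)"
      using C1 unfolding C1_on_def by blast
    have eq: "frechet_derivative f (at z) = f' z" if "z \<in> W" for z
      using frechet_derivative_at[OF f'(1)[OF that]] by simp
    have "continuous_on W (\<lambda>z. frechet_derivative f (at z) h)" for h
      by (rule continuous_on_eq[OF f'(2)]) (simp add: eq)
    then show ?thesis using f'(1) eq that by auto
  qed
  have c: "continuous_on W (\<lambda>z. frechet_derivative f (at z) h)" if "C1_on W f" for W h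
    using fr[OF that] by (cases "W = {}") auto
  show ?thesis
  proof (rule C1_onI)
    show "(f has_derivative frechet_derivative f (at z)) (at z)" if "z \<in> U \<union> V" for z
      using that fr[OF assms(1)] fr[OF assms(2)] by blast
    show "continuous_on (U \<union> V) (\<lambda>z. frechet_derivative f (at z) h)" for h
      by (intro continuous_on_open_Un assms(3,4) c assms(1,2))
  qed
qed

lemma dbar_mult:
  assumes "(f has_derivative f') (at z)" "(g has_derivative g') (at z)"
  shows "dbar (\<lambda>z. f z * g z) z = f z * dbar g z + dbar f z * g z"
  by (simp add: dbar_eq[OF has_derivative_mult[OF assms]] dbar_eq[OF assms(1)] dbar_eq[OF assms(2)] algebra_simps)

text \<open>
Composition with a holomorphic map sends the form \<open>dbar f d(cnj z)\<close> to its pullback, and \<open>cnj D\<close> is the factor by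
which \<open>d(cnj z)\<close> changes.
\<close>

lemma dbar_compose_holomorphic:
  assumes "(m has_field_derivative D) (at z)" "(f has_derivative f') (at (m z))"
  shows "dbar (\<lambda>z. f (m z)) z = cnj D * dbar f (m z)"
proof -
  have "((\<lambda>z. f (m z)) has_derivative (\<lambda>h. f' (D * h))) (at z)"
    using has_derivative_compose[OF assms(1)[unfolded has_field_derivative_def] assms(2)] .
  then have "dbar (\<lambda>z. f (m z)) z = f' D + \<i> * f' (D * \<i>)" by (simp add: dbar_eq)
  moreover have "f' D = Re D * f' 1 + Im D * f' \<i>" "f' (D * \<i>) = - Im D * f' 1 + Re D * f' \<i>"
    using has_derivative_complex_expand[OF assms(2), of D] has_derivative_complex_expand[OF assms(2), of "D * \<i>"]
    by (simp_all add: scaleR_conv_of_real)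
  moreover have "cnj D = Re D - \<i> * Im D" by (simp add: complex_eq_iff)
  ultimately show ?thesis by (simp only: dbar_eq[OF assms(2)]) (simp add: algebra_simps)
qed

lemma dbar_eq_0_outside_support:
  assumes "closed K" "\<And>z. z \<notin> K \<Longrightarrow> f z = 0" "z \<notin> K"
  shows "dbar f z = 0"
proof -
  have "(f has_derivative (\<lambda>_. 0)) (at z)"
    by (rule has_derivative_transform_within_open[of "\<lambda>_. 0" _ _ _ "- K"])
       (use assms in auto)
  then show ?thesis by (simp add: dbar_eq)
qed

lemma plane_integral_add:
  assumes "(\<lambda>v. F (of_plane v)) integrable_on UNIV" "(\<lambda>v. G (of_plane v)) integrable_on UNIV"
  shows "plane_integral (\<lambda>z. F z + G z) = plane_integral F + plane_integral G"
  unfolding plane_integral_def by (rule integral_add[OF assms])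

lemma plane_integral_cmult: "plane_integral (\<lambda>z. c * F z) = c * plane_integral F"
  unfolding plane_integral_def by (rule integral_mult_right)

text \<open>
Stokes' theorem for the compactly supported form \<open>F dz\<close> on the plane.
\<close>

lemma plane_integral_dbar_eq_0:
  assumes "C1_on UNIV F" "compact K" "\<And>z. z \<notin> K \<Longrightarrow> F z = 0"
  shows "plane_integral (dbar F) = 0"
proof -
  obtain F' where F': "\<And>z. (F has_derivative F' z) (at z)" "\<And>h. continuous_on UNIV (\<lambda>z. F' z h)"
    using assms(1) unfolding C1_on_def by blast
  have 0: "F' z h = 0" if "z \<notin> K" for z h
  proof -
    have "(F has_derivative (\<lambda>_. 0)) (at z)"
      by (rule has_derivative_transform_within_open[of "\<lambda>_. 0" _ _ _ "- K"])
         (use assms that compact_imp_closed in auto)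
    then show ?thesis using has_derivative_unique[OF F'(1)] by metis
  qed
  have "plane_integral (dbar F) = plane_integral (\<lambda>z. F' z 1 + \<i> * F' z \<i>)"
    using dbar_eq[OF F'(1)] by (intro arg_cong[where f=plane_integral]) auto
  also have "\<dots> = plane_integral (\<lambda>z. F' z 1) + plane_integral (\<lambda>z. \<i> * F' z \<i>)"
    by (rule plane_integral_add; rule plane_integrable[OF _ assms(2)])
       (use F' 0 in \<open>auto intro!: continuous_intros\<close>)
  also have "\<dots> = 0"
    unfolding plane_integral_cmult
    using plane_integral_derivative_eq_0[OF F' assms(2,3)] by simp
  finally show ?thesis .
qed

lemma plane_integral_sum:
  assumes "finite I" "\<And>i. i \<in> I \<Longrightarrow> continuous_on UNIV (f i)" "compact K" "\<And>i z. i \<in> I \<Longrightarrow> z \<notin> K \<Longrightarrow> f i z = 0"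
  shows "plane_integral (\<lambda>z. \<Sum>i\<in>I. f i z) = (\<Sum>i\<in>I. plane_integral (f i))"
  unfolding plane_integral_def
  by (rule integral_sum[OF assms(1)]) (use assms plane_integrable in blast)

text \<open>
A continuous nonnegative function with vanishing integral over a box is zero on that box. The corner point
\<open>(1, 1)\<close> is thrown into the support to make sure that the box has interior.
\<close>

lemma plane_integral_nonneg_eq_0:
  fixes p :: "complex \<Rightarrow> real"
  assumes cont: "continuous_on UNIV p" and K: "compact K" "\<And>z. z \<notin> K \<Longrightarrow> p z = 0"
    and nonneg: "\<And>z. p z \<ge> 0" and int: "plane_integral (\<lambda>z. of_real (p z)) = 0"
  shows "p z = 0"
proof -
  have "integrable lborel (\<lambda>v. p (of_plane v))"
    by (rule lborel_integrable_compact_support[OF cont K])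
  then have int_p: "(\<lambda>v. p (of_plane v)) integrable_on UNIV" by (rule integrable_on_lborel)
  have "plane_integral (\<lambda>z. of_real (p z)) = of_real (integral UNIV (\<lambda>v. p (of_plane v)))"
    unfolding plane_integral_def by (rule integral_linear[OF int_p bounded_linear_of_real, unfolded o_def])
  then have "((\<lambda>v. p (of_plane v)) has_integral 0) UNIV"
    using int int_p by (metis integrable_integral of_real_eq_0_iff)
  moreover have "bounded (to_plane ` insert (Complex 1 1) (insert z K))"
    by (intro compact_imp_bounded compact_continuous_image continuous_intros compact_insert K)
  then obtain a where a: "to_plane ` insert (Complex 1 1) (insert z K) \<subseteq> cbox (- a) a"
    using bounded_subset_cbox_symmetric by blast
  moreover have "p (of_plane v) = 0" if "v \<notin> cbox (- a) a" for v
    using that a K(2)[of "of_plane v"] by (metis image_subset_iff insertCI to_plane_of_plane)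
  then have "(\<lambda>v. if v \<in> cbox (- a) a then p (of_plane v) else 0) = (\<lambda>v. p (of_plane v))" by auto
  ultimately have "((\<lambda>v. p (of_plane v)) has_integral 0) (cbox (- a) a)"
    by (subst has_integral_restrict_UNIV[symmetric]) simp
  moreover have "continuous_on (cbox (- a) a) (\<lambda>v. p (of_plane v))"
    by (rule continuous_on_compose2[OF cont]) (auto intro: continuous_intros)
  moreover have "to_plane z \<in> cbox (- a) a" using a by auto
  moreover have "box (- a) a \<noteq> {}"
  proof -
    have "to_plane (Complex 1 1) \<in> cbox (- a) a" using a by auto
    then have "0 \<in> box (- a) a" by (simp add: mem_box_cart forall_2)
    then show ?thesis by blast
  qed
  ultimately have "p (of_plane (to_plane z)) = 0"
    using has_integral_0_cbox_imp_0[of "- a" a "\<lambda>v. p (of_plane v)"] nonneg by blast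
  then show ?thesis by simp
qed

section \<open>Cocompact Fuchsian groups lifted to matrices\<close>

text \<open>
This is \<open>2 cosh (d(\<i>, \<tau>))\<close> for the hyperbolic distance \<open>d\<close>, so its sublevel sets \<open>hyp_ball\<close> are the
closed hyperbolic balls around \<open>\<i>\<close>: a compact exhaustion of the half-plane given by polynomial inequalities.
\<close>

definition hyp_size :: "complex \<Rightarrow> real" where
  "hyp_size \<tau> = ((norm \<tau>)\<^sup>2 + 1) / Im \<tau>"

definition hyp_ball :: "real \<Rightarrow> complex set" where
  "hyp_ball A = {\<tau>. Im \<tau> > 0 \<and> hyp_size \<tau> \<le> A}"

lemma norm_le_sum_entries: "norm (A :: real^2^2) \<le> \<bar>A$1$1\<bar> + \<bar>A$1$2\<bar> + \<bar>A$2$1\<bar> + \<bar>A$2$2\<bar>"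
proof -
  have "norm A \<le> norm (A$1) + norm (A$2)"
    using L2_set_le_sum[of UNIV "\<lambda>i. norm (A$i)"] by (simp add: norm_vec_def sum_2)
  moreover have "norm (A$i) \<le> \<bar>A$i$1\<bar> + \<bar>A$i$2\<bar>" for i
    using L2_set_le_sum[of UNIV "\<lambda>j. norm (A$i$j)"] by (simp add: norm_vec_def sum_2)
  ultimately show ?thesis by (smt (verit))
qed

lemma abs_entry_le_norm: "\<bar>(A :: real^2^2)$i$j\<bar> \<le> norm A"
  using component_le_norm_cart[of "A $ i" j] Finite_Cartesian_Product.norm_nth_le[of A i] by linarith

text \<open>
The properties of the full preimage in \<open>SL(2,R)\<close> of a cocompact Fuchsian group that the analysis relies on.
Compactness of the quotient takes the form that every orbit meets one fixed hyperbolic ball.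
\<close>

locale lifted_cocompact_group =
  fixes G :: "(real^2^2) set"
  assumes det: "\<gamma> \<in> G \<Longrightarrow> det \<gamma> = 1"
    and one: "mat 1 \<in> G"
    and mult: "\<gamma> \<in> G \<Longrightarrow> \<delta> \<in> G \<Longrightarrow> \<gamma> ** \<delta> \<in> G"
    and adj: "\<gamma> \<in> G \<Longrightarrow> adj2 \<gamma> \<in> G"
    and discrete: "discrete G"
    and cover: "\<exists>A. \<forall>\<tau>. Im \<tau> > 0 \<longrightarrow> (\<exists>\<gamma>\<in>G. hyp_size (moebius \<gamma> \<tau>) < A)"

text \<open>
An element of the group is the coset \<open>{\<gamma>, -\<gamma>}\<close> of each of its members, so products and inverses in the
quotient lift to products and inverses of matrices.
\<close>

lemma lift_fuchsian:
  assumes "subgroup \<Gamma> PSL2R"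
  shows "\<And>\<gamma>. \<gamma> \<in> \<Union>\<Gamma> \<Longrightarrow> det \<gamma> = 1" and "mat 1 \<in> \<Union>\<Gamma>"
    and "\<And>\<gamma> \<delta>. \<gamma> \<in> \<Union>\<Gamma> \<Longrightarrow> \<delta> \<in> \<Union>\<Gamma> \<Longrightarrow> \<gamma> ** \<delta> \<in> \<Union>\<Gamma>"
    and "\<And>\<gamma>. \<gamma> \<in> \<Union>\<Gamma> \<Longrightarrow> adj2 \<gamma> \<in> \<Union>\<Gamma>"
proof -
  interpret N: normal "{mat 1, - mat 1}" SL2R by (rule normal_center_SL2R)
  interpret S: subgroup \<Gamma> PSL2R by (rule assms)
  have sub: "x \<in> rcosets\<^bsub>SL2R\<^esub> {mat 1, - mat 1}" if "x \<in> \<Gamma>" for x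
    using S.subset that by (auto simp: PSL2R_def FactGroup_def)
  have carr: "\<gamma> \<in> carrier SL2R" if "\<gamma> \<in> x" "x \<in> \<Gamma>" for \<gamma> x
    using N.rcosets_carrier[OF N.group_axioms sub[OF that(2)]] that(1) by auto
  then show det: "det \<gamma> = 1" if "\<gamma> \<in> \<Union>\<Gamma>" for \<gamma>
    using that by (auto simp: SL2R_def)
  have one: "{mat 1, - mat 1} \<in> \<Gamma>"
    using S.one_closed by (simp add: PSL2R_def FactGroup_def)
  then show "mat 1 \<in> \<Union>\<Gamma>" by auto
  have coset: "x = {mat 1, - mat 1} #>\<^bsub>SL2R\<^esub> \<gamma>" if \<gamma>x: "\<gamma> \<in> x" "x \<in> \<Gamma>" for \<gamma> x
  proof -
    obtain \<delta> where \<delta>: "\<delta> \<in> carrier SL2R" "x = {mat 1, - mat 1} #>\<^bsub>SL2R\<^esub> \<delta>"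
      using sub[OF \<gamma>x(2)] by (auto simp: RCOSETS_def)
    then show ?thesis using N.repr_independence[OF _ \<delta>(1) N.subgroup_axioms] \<gamma>x(1) by simp
  qed
  have prod: "\<gamma> ** \<delta> \<in> x \<otimes>\<^bsub>PSL2R\<^esub> y" if "\<gamma> \<in> x" "\<delta> \<in> y" for \<gamma> \<delta> x y
    using that by (auto simp: PSL2R_def FactGroup_def set_mult_def SL2R_def)
  show "\<gamma> ** \<delta> \<in> \<Union>\<Gamma>" if "\<gamma> \<in> \<Union>\<Gamma>" "\<delta> \<in> \<Union>\<Gamma>" for \<gamma> \<delta>
  proof -
    obtain x y where "\<gamma> \<in> x" "x \<in> \<Gamma>" "\<delta> \<in> y" "y \<in> \<Gamma>" using \<open>\<gamma> \<in> \<Union>\<Gamma>\<close> \<open>\<delta> \<in> \<Union>\<Gamma>\<close> by (elim UnionE)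
    then show ?thesis using UnionI[OF S.m_closed prod] by metis
  qed
  show "adj2 \<gamma> \<in> \<Union>\<Gamma>" if \<gamma>\<Gamma>: "\<gamma> \<in> \<Union>\<Gamma>" for \<gamma>
  proof -
    obtain x where x: "\<gamma> \<in> x" "x \<in> \<Gamma>" using \<gamma>\<Gamma> by (elim UnionE)
    have \<gamma>: "\<gamma> \<in> carrier SL2R" using carr x by blast
    have "inv\<^bsub>PSL2R\<^esub> x \<in> \<Gamma>" using x S.m_inv_closed by blast
    moreover have "inv\<^bsub>PSL2R\<^esub> x = {mat 1, - mat 1} #>\<^bsub>SL2R\<^esub> (inv\<^bsub>SL2R\<^esub> \<gamma>)"
      using N.inv_FactGroup[of x] sub[OF x(2)] N.rcos_inv[OF \<gamma>] coset[OF x]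
      by (simp add: PSL2R_def FactGroup_def)
    moreover have "inv\<^bsub>SL2R\<^esub> \<gamma> = adj2 \<gamma>"
      by (rule N.inv_equality) (use \<gamma> adj2_mult(2)[of \<gamma>] in \<open>auto simp: SL2R_def\<close>)
    moreover have "adj2 \<gamma> \<in> {mat 1, - mat 1} #>\<^bsub>SL2R\<^esub> adj2 \<gamma>"
      using N.rcos_self[OF _ N.subgroup_axioms, of "adj2 \<gamma>"] \<gamma> by (simp add: SL2R_def)
    ultimately show ?thesis using UnionI by metis
  qed
qed

lemma open_half_plane_moebius_vimage:
  assumes "det \<gamma> = 1" "open U"
  shows "open {\<tau>. Im \<tau> > 0 \<and> moebius \<gamma> \<tau> \<in> U}"
proof -
  have "open ({\<tau>. Im \<tau> > 0} \<inter> moebius \<gamma> -` U)"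
    using continuous_on_moebius[OF assms(1)] open_half_plane assms(2)
    by (metis continuous_on_open_vimage inf_commute)
  then show ?thesis by (simp add: Int_def vimage_def)
qed

lemma open_hyp_size_less: "open {\<tau>. Im \<tau> > 0 \<and> hyp_size \<tau> < A}"
proof -
  have "{\<tau>. Im \<tau> > 0 \<and> hyp_size \<tau> < A} = {\<tau>. Im \<tau> > 0} \<inter> {\<tau>. (norm \<tau>)\<^sup>2 + 1 < A * Im \<tau>}"
    by (auto simp: hyp_size_def field_simps)
  then show ?thesis by (simp add: open_Int open_Collect_less continuous_intros)
qed

lemma hyp_ball_bounds:
  assumes "\<tau> \<in> hyp_ball A"
  shows "A > 0" "norm \<tau> \<le> A" "Im \<tau> \<le> A" "1 / A \<le> Im \<tau>"
proof -
  have y: "Im \<tau> > 0" and q: "(norm \<tau>)\<^sup>2 + 1 \<le> A * Im \<tau>"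
    using assms by (auto simp: hyp_ball_def hyp_size_def field_simps)
  have "0 < (norm \<tau>)\<^sup>2 + 1" by (smt (verit) zero_le_power2)
  then have "0 < A * Im \<tau>" using q by linarith
  then show A: "A > 0" using y by (simp add: zero_less_mult_iff)
  have le: "Im \<tau> \<le> norm \<tau>" using abs_Im_le_cmod[of \<tau>] by linarith
  have "(norm \<tau>)\<^sup>2 \<le> A * norm \<tau>" using q mult_left_mono[OF le, of A] A by linarith
  then show n: "norm \<tau> \<le> A" using y le by (auto simp: power2_eq_square mult_le_cancel_right)
  then show "Im \<tau> \<le> A" using le by linarith
  have "1 \<le> A * Im \<tau>" using q zero_le_power2[of "norm \<tau>"] by linarith
  then show "1 / A \<le> Im \<tau>" using A by (simp add: field_simps)
qed

lemma compact_hyp_ball: "compact (hyp_ball A)"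
proof -
  have "hyp_ball A = {\<tau>. (norm \<tau>)\<^sup>2 + 1 \<le> A * Im \<tau>} \<inter> {\<tau>. 1 / A \<le> Im \<tau>} \<inter> {\<tau>. 0 \<le> A}"
  proof (intro equalityI subsetI)
    fix \<tau> assume "\<tau> \<in> hyp_ball A"
    then show "\<tau> \<in> {\<tau>. (norm \<tau>)\<^sup>2 + 1 \<le> A * Im \<tau>} \<inter> {\<tau>. 1 / A \<le> Im \<tau>} \<inter> {\<tau>. 0 \<le> A}"
      using hyp_ball_bounds[of \<tau> A] by (auto simp: hyp_ball_def hyp_size_def field_simps)
  next
    fix \<tau> assume \<tau>: "\<tau> \<in> {\<tau>. (norm \<tau>)\<^sup>2 + 1 \<le> A * Im \<tau>} \<inter> {\<tau>. 1 / A \<le> Im \<tau>} \<inter> {\<tau>. 0 \<le> A}"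
    have "0 < (norm \<tau>)\<^sup>2 + 1" by (smt (verit) zero_le_power2)
    then have "0 < A * Im \<tau>" using \<tau> by simp
    then have "Im \<tau> > 0" using \<tau> by (auto simp: zero_less_mult_iff split: if_splits)
    then show "\<tau> \<in> hyp_ball A" using \<tau> by (auto simp: hyp_ball_def hyp_size_def field_simps)
  qed
  moreover have "closed ({\<tau>. (norm \<tau>)\<^sup>2 + 1 \<le> A * Im \<tau>} \<inter> {\<tau>. 1 / A \<le> Im \<tau>} \<inter> {\<tau>. 0 \<le> A})"
    by (intro closed_Int closed_Collect_le continuous_intros)
  moreover have "bounded (hyp_ball A)"
    using hyp_ball_bounds(2) by (auto simp: bounded_iff)
  ultimately show ?thesis by (simp add: compact_eq_bounded_closed)
qed

text \<open>
The images in the orbit space of the open hyperbolic balls around \<open>\<i>\<close> form an increasing open cover. By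
compactness finitely many of them suffice, hence the largest one does.
\<close>

lemma cocompact_fuchsian_imp_lifted:
  assumes "cocompact_fuchsian \<Gamma>"
  shows "lifted_cocompact_group (\<Union>\<Gamma>)"
proof -
  have sg: "subgroup \<Gamma> PSL2R" and d: "discrete (\<Union>\<Gamma>)" and cpt: "compact_space (orbit_space \<Gamma>)"
    using assms by (auto simp: cocompact_fuchsian_def fuchsian_def)
  note L = lift_fuchsian[OF sg]
  have top: "topspace (orbit_space \<Gamma>) = orbit \<Gamma> ` upper_half_plane"
  proof -
    have "{\<tau> \<in> upper_half_plane. orbit \<Gamma> \<tau> \<in> orbit \<Gamma> ` upper_half_plane} = {\<tau>. Im \<tau> > 0}"
      by (auto simp: upper_half_plane_def)
    then have "openin (orbit_space \<Gamma>) (orbit \<Gamma> ` upper_half_plane)"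
      by (simp add: openin_orbit_space open_half_plane)
    then show ?thesis
      by (intro equalityI) (auto simp: topspace_def openin_orbit_space)
  qed
  define U where "U A = orbit \<Gamma> ` {\<sigma>. Im \<sigma> > 0 \<and> hyp_size \<sigma> < A}" for A
  have mem: "orbit \<Gamma> \<tau> \<in> U A \<longleftrightarrow> (\<exists>\<gamma>\<in>\<Union>\<Gamma>. hyp_size (moebius \<gamma> \<tau>) < A)" if \<tau>: "Im \<tau> > 0" for \<tau> A
  proof
    assume "orbit \<Gamma> \<tau> \<in> U A"
    then obtain \<sigma> where \<sigma>: "Im \<sigma> > 0" "hyp_size \<sigma> < A" "orbit \<Gamma> \<tau> = orbit \<Gamma> \<sigma>" by (auto simp: U_def)
    have "moebius (mat 1) \<sigma> = \<sigma>" by (simp add: moebius_def aut_factor_def mat_def)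
    then have "\<sigma> \<in> orbit \<Gamma> \<sigma>" using L(2) unfolding orbit_def by force
    then have "\<sigma> \<in> orbit \<Gamma> \<tau>" using \<sigma>(3) by simp
    then obtain \<gamma> where "\<gamma> \<in> \<Union>\<Gamma>" "\<sigma> = moebius \<gamma> \<tau>" unfolding orbit_def by blast
    then show "\<exists>\<gamma>\<in>\<Union>\<Gamma>. hyp_size (moebius \<gamma> \<tau>) < A" using \<sigma> by blast
  next
    assume "\<exists>\<gamma>\<in>\<Union>\<Gamma>. hyp_size (moebius \<gamma> \<tau>) < A"
    then obtain \<gamma> where \<gamma>: "\<gamma> \<in> \<Union>\<Gamma>" "hyp_size (moebius \<gamma> \<tau>) < A" by blast
    note d\<gamma> = L(1)[OF \<gamma>(1)]
    have "orbit \<Gamma> \<tau> = orbit \<Gamma> (moebius \<gamma> \<tau>)"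
    proof (intro equalityI subsetI)
      fix z assume "z \<in> orbit \<Gamma> \<tau>"
      then obtain \<delta> where \<delta>: "\<delta> \<in> \<Union>\<Gamma>" "z = moebius \<delta> \<tau>" by (auto simp: orbit_def)
      have "moebius (\<delta> ** adj2 \<gamma>) (moebius \<gamma> \<tau>) = z"
        using moebius_mult(2)[of "adj2 \<gamma>" "moebius \<gamma> \<tau>" \<delta>] moebius_inverse(1)[of "adj2 \<gamma>" \<gamma> \<tau>]
          d\<gamma> adj2_mult(2) \<tau> Im_moebius_pos[OF d\<gamma> \<tau>] \<delta> by simp
      then show "z \<in> orbit \<Gamma> (moebius \<gamma> \<tau>)"
        using L(3)[OF \<delta>(1) L(4)[OF \<gamma>(1)]] unfolding orbit_def by force
    next
      fix z assume "z \<in> orbit \<Gamma> (moebius \<gamma> \<tau>)"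
      then obtain \<delta> where \<delta>: "\<delta> \<in> \<Union>\<Gamma>" "z = moebius \<delta> (moebius \<gamma> \<tau>)" by (auto simp: orbit_def)
      then have "moebius (\<delta> ** \<gamma>) \<tau> = z" using moebius_mult(2)[OF d\<gamma> \<tau>] by simp
      then show "z \<in> orbit \<Gamma> \<tau>" using L(3)[OF \<delta>(1) \<gamma>(1)] unfolding orbit_def by force
    qed
    then show "orbit \<Gamma> \<tau> \<in> U A"
      using \<gamma>(2) Im_moebius_pos[OF d\<gamma> \<tau>] by (auto simp: U_def)
  qed
  have openU: "openin (orbit_space \<Gamma>) (U A)" for A
  proof -
    have "{\<tau> \<in> upper_half_plane. orbit \<Gamma> \<tau> \<in> U A} =
        (\<Union>\<gamma>\<in>\<Union>\<Gamma>. {\<tau>. Im \<tau> > 0 \<and> moebius \<gamma> \<tau> \<in> {\<sigma>. Im \<sigma> > 0 \<and> hyp_size \<sigma> < A}})"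
    proof (rule Set.set_eqI)
      fix \<tau>
      have "Im (moebius \<gamma> \<tau>) > 0" if "\<gamma> \<in> \<Union>\<Gamma>" "Im \<tau> > 0" for \<gamma>
        using Im_moebius_pos[OF L(1)] that by blast
      then show "\<tau> \<in> {\<tau> \<in> upper_half_plane. orbit \<Gamma> \<tau> \<in> U A} \<longleftrightarrow>
          \<tau> \<in> (\<Union>\<gamma>\<in>\<Union>\<Gamma>. {\<tau>. Im \<tau> > 0 \<and> moebius \<gamma> \<tau> \<in> {\<sigma>. Im \<sigma> > 0 \<and> hyp_size \<sigma> < A}})"
        using mem[of \<tau> A] unfolding upper_half_plane_def by blast
    qed
    moreover have "open \<dots>"
      by (intro open_UN ballI open_half_plane_moebius_vimage open_hyp_size_less L(1))
    ultimately show ?thesis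
      by (auto simp: openin_orbit_space U_def upper_half_plane_def)
  qed
  have "topspace (orbit_space \<Gamma>) \<subseteq> \<Union>(range U)"
  proof
    fix x assume "x \<in> topspace (orbit_space \<Gamma>)"
    then obtain \<tau> where "Im \<tau> > 0" "x = orbit \<Gamma> \<tau>" by (auto simp: top upper_half_plane_def)
    then have "x \<in> U (hyp_size \<tau> + 1)" by (auto simp: U_def)
    then show "x \<in> \<Union>(range U)" by blast
  qed
  then obtain \<F> where \<F>: "finite \<F>" "\<F> \<subseteq> range U" "topspace (orbit_space \<Gamma>) \<subseteq> \<Union>\<F>"
    using cpt openU unfolding compact_space_alt by (metis (no_types, lifting) imageE)
  obtain B where B: "finite B" "\<F> = U ` B" using finite_subset_image[OF \<F>(1,2)] by auto
  have "\<exists>\<gamma>\<in>\<Union>\<Gamma>. hyp_size (moebius \<gamma> \<tau>) < Max (insert 0 B)" if \<tau>: "Im \<tau> > 0" for \<tau>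
  proof -
    have "orbit \<Gamma> \<tau> \<in> topspace (orbit_space \<Gamma>)" using \<tau> by (auto simp: top upper_half_plane_def)
    then obtain A where A: "A \<in> B" "orbit \<Gamma> \<tau> \<in> U A" using \<F>(3) B(2) by auto
    then have "A \<le> Max (insert 0 B)" using B(1) by simp
    then show ?thesis using A(2) mem[OF \<tau>] by force
  qed
  then show ?thesis
    by unfold_locales (use L d in auto)
qed

context lifted_cocompact_group
begin

text \<open>
A discrete subgroup has no accumulation points at all: if \<open>A\<close> and \<open>B\<close> are distinct but close members of a bounded
subset, then \<open>A^(-1) B\<close> is a member close to, and different from, the identity.
\<close>

lemma finite_bounded_subset:
  assumes "bounded S" "S \<subseteq> G"
  shows "finite S"
proof (rule ccontr)
  assume "infinite S"
  then obtain x where x: "x islimpt S" using Bolzano_Weierstrass_imp_closed bounded_infinite_imp_islimpt assms(1) by blast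
  obtain C where C: "\<And>A. A \<in> S \<Longrightarrow> norm A \<le> C" using assms(1) by (auto simp: bounded_iff)
  obtain e where e: "e > 0" "\<And>B. B \<in> G \<Longrightarrow> dist (mat 1) B < e \<Longrightarrow> B = mat 1"
    using discreteD[OF discrete one] by (auto simp: isolated_in_dist_Ex_iff)
  \<comment> \<open>Each of the four entries of \<open>A^(-1) (A - B)\<close> is a sum of two products that are at most \<open>|C| d\<close>; the summand \<open>8\<close> prevents division by zero.\<close>
  define d where "d = e / (8 * \<bar>C\<bar> + 8)"
  have d: "d > 0" using e(1) by (simp add: d_def)
  obtain A where A: "A \<in> S" "A \<noteq> x" "dist A x < d / 2"
    using x d unfolding islimpt_approachable by (metis half_gt_zero)
  obtain B where B: "B \<in> S" "B \<noteq> x" "dist B x < min (d / 2) (dist A x)"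
    using x d A(2) unfolding islimpt_approachable by (metis half_gt_zero min_less_iff_conj zero_less_dist_iff)
  have "A \<noteq> B" using B(3) by auto
  have AB: "norm (A - B) < d"
    using A(3) B(3) dist_triangle_half_l[of A x d B] by (simp add: dist_norm dist_commute)
  have AG: "A \<in> G" "B \<in> G" using A B assms by auto
  have "norm (mat 1 - adj2 A ** B) = norm (adj2 A ** (A - B))"
    using adj2_mult(2)[OF det[OF AG(1)]]
    by (intro arg_cong[where f=norm]) (simp add: vec_eq_iff forall_2 matrix_matrix_mult_def sum_2 algebra_simps)
  moreover have E: "\<bar>(adj2 A ** (A - B)) $ i $ j\<bar> \<le> 2 * \<bar>C\<bar> * d" for i j
  proof -
    have a: "\<bar>adj2 A $ i $ k\<bar> \<le> \<bar>C\<bar>" for i k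
    proof -
      have "\<forall>i k. \<bar>adj2 A $ i $ k\<bar> \<le> norm A"
        using abs_entry_le_norm[of A] by (simp add: forall_2)
      then show ?thesis using C[OF A(1)] by (meson abs_ge_self order_trans)
    qed
    have b: "\<bar>(A - B) $ k $ j\<bar> \<le> d" for k using abs_entry_le_norm[of "A - B" k j] AB by linarith
    have P: "\<bar>adj2 A $ i $ k * (A - B) $ k $ j\<bar> \<le> \<bar>C\<bar> * d" for k
      unfolding abs_mult by (intro mult_mono a b) auto
    have "\<bar>(adj2 A ** (A - B)) $ i $ j\<bar> \<le>
        \<bar>adj2 A $ i $ 1 * (A - B) $ 1 $ j\<bar> + \<bar>adj2 A $ i $ 2 * (A - B) $ 2 $ j\<bar>"
      unfolding matrix_matrix_mult_def by (simp add: sum_2 abs_triangle_ineq)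
    then show ?thesis using P[of 1] P[of 2] by linarith
  qed
  ultimately have "norm (mat 1 - adj2 A ** B) \<le> 8 * \<bar>C\<bar> * d"
    using norm_le_sum_entries[of "adj2 A ** (A - B)"] E[of 1 1] E[of 1 2] E[of 2 1] E[of 2 2] by linarith
  also have "\<dots> < e"
    using e(1) by (simp add: d_def field_simps)
  finally have "adj2 A ** B = mat 1"
    using e(2)[OF mult[OF adj[OF AG(1)] AG(2)]] by (simp add: dist_norm)
  then have "A ** (adj2 A ** B) = A" by simp
  then have "B = A" using adj2_mult(1)[OF det[OF AG(1)]] by (simp add: matrix_mul_assoc)
  then show False using \<open>A \<noteq> B\<close> by simp
qed

text \<open>
Proper discontinuity. If \<open>\<tau>\<close> and \<open>\<gamma>\<tau>\<close> lie in one ball, then \<open>|j|^2 = Im \<tau> / Im (\<gamma>\<tau>)\<close> is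
bounded; hence so are \<open>c\<tau> + d\<close> and \<open>a\<tau> + b = j (\<gamma>\<tau>)\<close>, and with them the entries of
\<open>\<gamma>\<close>.
\<close>

lemma finite_ball_overlaps:
  "finite {\<gamma> \<in> G. \<exists>\<tau>. \<tau> \<in> hyp_ball A \<and> moebius \<gamma> \<tau> \<in> hyp_ball A}" (is "finite ?F")
proof (rule finite_bounded_subset)
  have "norm \<gamma> \<le> A ^ 3 + (A\<^sup>2 + A ^ 3 * A) + A\<^sup>2 + (A + A\<^sup>2 * A)" if "\<gamma> \<in> ?F" for \<gamma>
  proof -
    obtain \<tau> where \<gamma>: "det \<gamma> = 1" and \<tau>: "\<tau> \<in> hyp_ball A" "moebius \<gamma> \<tau> \<in> hyp_ball A"
      using \<open>\<gamma> \<in> ?F\<close> det by blast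
    note b = hyp_ball_bounds[OF \<tau>(1)] and b' = hyp_ball_bounds[OF \<tau>(2)]
    have y: "Im \<tau> > 0" using \<tau>(1) by (simp add: hyp_ball_def)
    define j where "j = aut_factor \<gamma> \<tau>"
    have j0: "j \<noteq> 0" using aut_factor_nonzero[OF \<gamma> y] by (simp add: j_def)
    have "(norm j)\<^sup>2 * Im (moebius \<gamma> \<tau>) = Im \<tau>"
      using j0 by (simp add: Im_moebius[OF \<gamma> y] j_def)
    moreover have "(norm j)\<^sup>2 * (1 / A) \<le> (norm j)\<^sup>2 * Im (moebius \<gamma> \<tau>)"
      using b'(4) by (intro mult_left_mono) auto
    ultimately have "(norm j)\<^sup>2 * (1 / A) \<le> A" using b(3) by linarith
    then have "(norm j)\<^sup>2 \<le> A\<^sup>2" using b(1) by (simp add: field_simps power2_eq_square)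
    then have j: "norm j \<le> A" using b(1) by (simp add: power2_le_iff_abs_le)
    have lin: "\<bar>u\<bar> \<le> A * B \<and> \<bar>v\<bar> \<le> B + A * B * A"
      if "norm (of_real u * \<tau> + of_real v) \<le> B" for u v B
    proof -
      have "\<bar>u\<bar> * Im \<tau> \<le> B"
        using abs_Im_le_cmod[of "of_real u * \<tau> + of_real v"] that y by (simp add: abs_mult)
      moreover have "\<bar>u\<bar> * (1 / A) \<le> \<bar>u\<bar> * Im \<tau>" using b(4) by (intro mult_left_mono) auto
      ultimately have "\<bar>u\<bar> * (1 / A) \<le> B" by linarith
      then have u: "\<bar>u\<bar> \<le> A * B" using b(1) by (simp add: field_simps)
      have "\<bar>v\<bar> = norm ((of_real u * \<tau> + of_real v) - of_real u * \<tau>)" by simp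
      also have "\<dots> \<le> B + \<bar>u\<bar> * norm \<tau>"
        using norm_triangle_ineq4[of "of_real u * \<tau> + of_real v" "of_real u * \<tau>"] that
        by (simp add: norm_mult)
      also have "\<bar>u\<bar> * norm \<tau> \<le> A * B * A"
        using u b by (intro mult_mono) auto
      finally show ?thesis using u by simp
    qed
    have "of_real (\<gamma>$1$1) * \<tau> + of_real (\<gamma>$1$2) = moebius \<gamma> \<tau> * j"
      using j0 by (simp add: moebius_def j_def)
    moreover have "norm (moebius \<gamma> \<tau> * j) \<le> A * A"
      unfolding norm_mult using b'(2) j b(1) by (intro mult_mono) auto
    ultimately have 1: "\<bar>\<gamma>$1$1\<bar> \<le> A * (A * A) \<and> \<bar>\<gamma>$1$2\<bar> \<le> A * A + A * (A * A) * A"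
      by (intro lin) simp
    have 2: "\<bar>\<gamma>$2$1\<bar> \<le> A * A \<and> \<bar>\<gamma>$2$2\<bar> \<le> A + A * A * A"
      using j by (intro lin) (simp add: j_def aut_factor_def)
    show ?thesis using norm_le_sum_entries[of \<gamma>] 1 2 by (simp add: power2_eq_square power3_eq_cube)
  qed
  then show "bounded ?F" unfolding bounded_iff by blast
qed auto

end

lemma hyp_ball_subset: "hyp_ball A \<subseteq> {\<tau>. Im \<tau> > 0}"
  by (auto simp: hyp_ball_def)

section \<open>The maximum principle for automorphic forms\<close>

context lifted_cocompact_group
begin

lemma invariant_attains_max:
  assumes cont: "continuous_on {\<tau>. Im \<tau> > 0} N"
    and inv: "\<And>\<gamma> \<tau>. \<gamma> \<in> G \<Longrightarrow> Im \<tau> > 0 \<Longrightarrow> N (moebius \<gamma> \<tau>) = (N \<tau> :: real)"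
  obtains \<tau>0 where "Im \<tau>0 > 0" "\<And>\<tau>. Im \<tau> > 0 \<Longrightarrow> N \<tau> \<le> N \<tau>0"
proof -
  obtain A where A: "\<And>\<tau>. Im \<tau> > 0 \<Longrightarrow> \<exists>\<gamma>\<in>G. hyp_size (moebius \<gamma> \<tau>) < A" using cover by blast
  have ball: "\<exists>\<gamma>\<in>G. moebius \<gamma> \<tau> \<in> hyp_ball A" if "Im \<tau> > 0" for \<tau>
    using A[OF that] Im_moebius_pos[OF det that] by (fastforce simp: hyp_ball_def)
  have "hyp_ball A \<noteq> {}" using ball[of \<i>] by auto
  then obtain \<tau>0 where \<tau>0: "\<tau>0 \<in> hyp_ball A" "\<And>\<tau>. \<tau> \<in> hyp_ball A \<Longrightarrow> N \<tau> \<le> N \<tau>0"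
    using continuous_attains_sup[OF compact_hyp_ball _ continuous_on_subset[OF cont hyp_ball_subset]] by blast
  have "N \<tau> \<le> N \<tau>0" if "Im \<tau> > 0" for \<tau>
    using ball[OF that] \<tau>0(2) inv[OF _ that] by metis
  then show ?thesis using that \<tau>0(1) hyp_ball_subset by blast
qed

text \<open>
Let \<open>h\<close> have weight \<open>-2m\<close>. The invariant function \<open>N = |h| y^(-m)\<close> attains its maximum at some
\<open>\<tau>0\<close>. For \<open>F = h / (\<tau> - cnj \<tau>0)^(2m)\<close> one has \<open>|F| = N (y / |\<tau> - cnj \<tau>0|^2)^m\<close>, and the second
factor is maximal at \<open>\<tau>0\<close> too, because \<open>|\<tau> - cnj \<tau>0|^2 \<ge> 4 y Im \<tau>0\<close>. So \<open>F\<close> is constant. As the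
second factor is strictly smaller elsewhere when \<open>m > 0\<close>, the maximum of \<open>N\<close> is then zero.
\<close>

lemma nonpositive_weight_constant:
  assumes hol: "h holomorphic_on {\<tau>. Im \<tau> > 0}"
    and inv: "\<And>\<gamma> \<tau>. \<gamma> \<in> G \<Longrightarrow> Im \<tau> > 0 \<Longrightarrow> h (moebius \<gamma> \<tau>) * aut_factor \<gamma> \<tau> ^ (2 * m) = h \<tau>"
  shows "h constant_on {\<tau>. Im \<tau> > 0}" and "m > 0 \<Longrightarrow> Im \<tau> > 0 \<Longrightarrow> h \<tau> = 0"
proof -
  define N where "N \<tau> = norm (h \<tau>) / Im \<tau> ^ m" for \<tau>
  have Ninv: "N (moebius \<gamma> \<tau>) = N \<tau>" if "\<gamma> \<in> G" "Im \<tau> > 0" for \<gamma> \<tau>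
  proof -
    have j: "norm (aut_factor \<gamma> \<tau>) > 0" using aut_factor_nonzero[OF det[OF that(1)] that(2)] by simp
    have "norm (h \<tau>) = norm (h (moebius \<gamma> \<tau>)) * (norm (aut_factor \<gamma> \<tau>))\<^sup>2 ^ m"
      by (simp flip: inv[OF that] add: norm_mult norm_power power_mult)
    then show ?thesis
      using j that(2) by (simp add: N_def Im_moebius[OF det[OF that(1)] that(2)] power_divide)
  qed
  have "continuous_on {\<tau>. Im \<tau> > 0} N"
    unfolding N_def by (intro continuous_intros holomorphic_on_imp_continuous_on[OF hol]) auto
  then obtain \<tau>0 where \<tau>0: "Im \<tau>0 > 0" "\<And>\<tau>. Im \<tau> > 0 \<Longrightarrow> N \<tau> \<le> N \<tau>0"
    using invariant_attains_max[of N] Ninv by blast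
  define F where "F \<tau> = h \<tau> / (\<tau> - cnj \<tau>0) ^ (2 * m)" for \<tau>
  have nz: "\<tau> - cnj \<tau>0 \<noteq> 0" if "Im \<tau> > 0" for \<tau>
    using that \<tau>0(1) by (auto simp: complex_eq_iff)
  have normF: "norm (F \<tau>) = N \<tau> * (Im \<tau> / (norm (\<tau> - cnj \<tau>0))\<^sup>2) ^ m" if "Im \<tau> > 0" for \<tau>
    using that by (simp add: F_def N_def norm_divide norm_power power_divide power_mult)
  have n0: "Im \<tau>0 / (norm (\<tau>0 - cnj \<tau>0))\<^sup>2 = 1 / (4 * Im \<tau>0)"
  proof -
    have "(norm (\<tau>0 - cnj \<tau>0))\<^sup>2 = 4 * (Im \<tau>0)\<^sup>2" by (subst cmod_power2) (simp add: power2_eq_square)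
    then show ?thesis using \<tau>0(1) by (simp add: power2_eq_square)
  qed
  have N0: "N \<tau> \<ge> 0" if "Im \<tau> > 0" for \<tau> using that by (simp add: N_def)
  have le: "norm (F \<tau>) \<le> norm (F \<tau>0)" if \<tau>: "Im \<tau> > 0" for \<tau>
  proof -
    have "4 * Im \<tau> * Im \<tau>0 \<le> (norm (\<tau> - cnj \<tau>0))\<^sup>2"
    proof -
      have "(norm (\<tau> - cnj \<tau>0))\<^sup>2 - 4 * Im \<tau> * Im \<tau>0 = (Re \<tau> - Re \<tau>0)\<^sup>2 + (Im \<tau> - Im \<tau>0)\<^sup>2"
        by (subst cmod_power2) (simp add: power2_eq_square algebra_simps)
      then show ?thesis by (smt (verit) zero_le_power2)
    qed
    moreover have "(norm (\<tau> - cnj \<tau>0))\<^sup>2 > 0" using nz[OF \<tau>] by simp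
    ultimately have "Im \<tau> / (norm (\<tau> - cnj \<tau>0))\<^sup>2 \<le> 1 / (4 * Im \<tau>0)"
      using \<tau>0(1) by (simp add: field_simps)
    then show ?thesis
      unfolding normF[OF \<tau>] normF[OF \<tau>0(1)] n0
      using \<tau>0 \<tau> N0 by (intro mult_mono power_mono) auto
  qed
  have "F constant_on {\<tau>. Im \<tau> > 0}"
  proof (rule maximum_modulus_principle)
    show "F holomorphic_on {\<tau>. Im \<tau> > 0}"
      unfolding F_def using nz by (intro holomorphic_intros hol) auto
    show "connected {\<tau>. Im \<tau> > 0}" by (simp add: convex_connected convex_halfspace_Im_gt)
  qed (use open_half_plane \<tau>0(1) le in auto)
  then obtain c where c: "\<And>\<tau>. Im \<tau> > 0 \<Longrightarrow> F \<tau> = c" by (auto simp: constant_on_def)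
  have zero: "h \<tau> = 0" if "m > 0" "Im \<tau> > 0" for \<tau>
  proof -
    \<comment> \<open>Any second point serves; for this one the second factor of \<open>|F|\<close> has the base \<open>1/(5 y)\<close> in place of the maximal \<open>1/(4 y)\<close>.\<close>
    define \<tau>1 where "\<tau>1 = \<tau>0 + of_real (Im \<tau>0)"
    have \<tau>1: "Im \<tau>1 > 0" using \<tau>0(1) by (simp add: \<tau>1_def)
    have n1: "Im \<tau>1 / (norm (\<tau>1 - cnj \<tau>0))\<^sup>2 = 1 / (5 * Im \<tau>0)"
    proof -
      have "(norm (\<tau>1 - cnj \<tau>0))\<^sup>2 = 5 * (Im \<tau>0)\<^sup>2" by (subst cmod_power2) (simp add: \<tau>1_def power2_eq_square)
      then show ?thesis using \<tau>0(1) by (simp add: \<tau>1_def power2_eq_square)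
    qed
    have "N \<tau>0 * (1 / (4 * Im \<tau>0)) ^ m = N \<tau>1 * (1 / (5 * Im \<tau>0)) ^ m"
      using normF[OF \<tau>0(1)] normF[OF \<tau>1] n0 n1 c[OF \<tau>0(1)] c[OF \<tau>1] by simp
    also have "\<dots> \<le> N \<tau>0 * (1 / (5 * Im \<tau>0)) ^ m"
      using \<tau>0 \<tau>1 by (intro mult_right_mono) auto
    finally have "N \<tau>0 * (1 / (4 * Im \<tau>0)) ^ m \<le> N \<tau>0 * (1 / (5 * Im \<tau>0)) ^ m" .
    moreover have "(1 / (5 * Im \<tau>0)) ^ m < (1 / (4 * Im \<tau>0)) ^ m"
      using \<tau>0(1) that(1) by (intro power_strict_mono) (auto simp: field_simps)
    ultimately have "N \<tau>0 \<le> 0"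
      by (meson mult_less_cancel_left_pos not_le)
    then have "N \<tau> = 0" using \<tau>0(2)[OF that(2)] N0[OF that(2)] by linarith
    then show ?thesis using that(2) by (simp add: N_def)
  qed
  then show "m > 0 \<Longrightarrow> Im \<tau> > 0 \<Longrightarrow> h \<tau> = 0" .
  show "h constant_on {\<tau>. Im \<tau> > 0}"
  proof (cases "m = 0")
    case True
    then have "F = h" by (auto simp: F_def)
    then show ?thesis using \<open>F constant_on _\<close> by simp
  next
    case False
    then show ?thesis using zero by (auto simp: constant_on_def)
  qed
qed

end

section \<open>A partition of unity indexed by the group\<close>

lemma continuous_on_zero_extension:
  fixes f :: "complex \<Rightarrow> 'b::real_normed_vector"
  assumes "continuous_on {\<tau>. Im \<tau> > 0} f" "\<And>\<tau>. \<tau> \<notin> hyp_ball A \<Longrightarrow> f \<tau> = 0"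
  shows "continuous_on UNIV f"
proof -
  have op: "open (- hyp_ball A)" using compact_hyp_ball by (simp add: open_Compl compact_imp_closed)
  have "continuous_on (- hyp_ball A) f"
    using continuous_on_const[of "- hyp_ball A" 0] by (rule continuous_on_eq) (use assms in auto)
  then have "continuous_on ({\<tau>. Im \<tau> > 0} \<union> - hyp_ball A) f"
    by (intro continuous_on_open_Un open_half_plane op assms)
  moreover have "{\<tau>. Im \<tau> > 0} \<union> - hyp_ball A = UNIV" using hyp_ball_subset by auto
  ultimately show ?thesis by simp
qed

lemma C1_on_zero_extension:
  assumes "C1_on {\<tau>. Im \<tau> > 0} f" "\<And>\<tau>. \<tau> \<notin> hyp_ball A \<Longrightarrow> f \<tau> = 0"
  shows "C1_on UNIV f"
proof -
  have op: "open (- hyp_ball A)" using compact_hyp_ball by (simp add: open_Compl compact_imp_closed)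
  have "C1_on (- hyp_ball A) f"
    by (rule C1_on_cong[OF C1_on_const[of _ 0] op]) (use assms in auto)
  then have "C1_on ({\<tau>. Im \<tau> > 0} \<union> - hyp_ball A) f"
    by (intro C1_on_Un open_half_plane op assms)
  moreover have "{\<tau>. Im \<tau> > 0} \<union> - hyp_ball A = UNIV" using hyp_ball_subset by auto
  ultimately show ?thesis by simp
qed

lemma has_real_derivative_max_0_squared:
  "((\<lambda>t::real. (max 0 t)\<^sup>2) has_real_derivative 2 * max 0 t) (at t)"
proof -
  consider "t > 0" | "t < 0" | "t = 0" by linarith
  then show ?thesis
  proof cases
    case 1
    have "((\<lambda>t::real. t\<^sup>2) has_real_derivative 2 * t) (at t)" by (auto intro!: derivative_eq_intros)
    then have "((\<lambda>t::real. (max 0 t)\<^sup>2) has_real_derivative 2 * t) (at t)"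
      by (rule has_field_derivative_transform_within_open[where S="{0<..}"]) (use 1 in auto)
    then show ?thesis using 1 by simp
  next
    case 2
    have "((\<lambda>t::real. (max 0 t)\<^sup>2) has_real_derivative 0) (at t)"
      by (rule has_field_derivative_transform_within_open[of "\<lambda>_. 0" _ _ "{..<0}"]) (use 2 in auto)
    then show ?thesis using 2 by simp
  next
    case 3
    have "((\<lambda>h::real. (max 0 h)\<^sup>2 / h) \<longlongrightarrow> 0) (at 0)"
    proof (rule Lim_null_comparison)
      have "norm ((max 0 h)\<^sup>2 / h) \<le> \<bar>h\<bar>" for h :: real
        by (cases "h > 0") (auto simp: power2_eq_square)
      then show "\<forall>\<^sub>F h in at 0. norm ((max 0 h)\<^sup>2 / h) \<le> \<bar>h :: real\<bar>" by simp
      show "((\<lambda>h::real. \<bar>h\<bar>) \<longlongrightarrow> 0) (at 0)" by (intro tendsto_eq_intros) auto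
    qed
    then show ?thesis using 3 by (simp add: DERIV_def)
  qed
qed

lemma C1_on_hyp_size: "C1_on {\<tau>. Im \<tau> > 0} hyp_size"
proof -
  have "C1_on {\<tau>. Im \<tau> > 0} (\<lambda>\<tau>. (Re \<tau> * Re \<tau> + Im \<tau> * Im \<tau> + 1) * inverse (Im \<tau>))"
    by (intro C1_on_mult C1_on_add C1_on_inverse C1_on_const C1_on_bounded_linear bounded_linear_Re bounded_linear_Im) auto
  moreover have "hyp_size = (\<lambda>\<tau>. (Re \<tau> * Re \<tau> + Im \<tau> * Im \<tau> + 1) * inverse (Im \<tau>))"
    by (rule ext) (simp only: hyp_size_def cmod_power2, simp only: divide_inverse power2_eq_square)
  ultimately show ?thesis by simp
qed

context lifted_cocompact_group
begin

text \<open>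
A \<open>C^1\<close> bump function, positive on a ball that meets every orbit, is divided by the sum of its translates. The sum is
invariant and positive, and locally finite by proper discontinuity. \<open>F\<close> collects the finitely many group
elements that matter on the neighbourhood \<open>U\<close> of the support of \<open>\<phi>\<close>; closure under inverses makes
unfolding a reindexing of a finite sum.
\<close>

lemma invariant_partition_of_unity:
  obtains \<phi> :: "complex \<Rightarrow> real" and F A U where
    "C1_on UNIV \<phi>" "\<And>\<tau>. \<phi> \<tau> \<ge> 0" "\<And>\<tau>. \<tau> \<notin> hyp_ball A \<Longrightarrow> \<phi> \<tau> = 0" "hyp_ball A \<noteq> {}"
    "finite F" "F \<subseteq> G" "adj2 ` F = F" "open U" "hyp_ball A \<subseteq> U" "U \<subseteq> {\<tau>. Im \<tau> > 0}"
    "\<And>\<tau>. \<tau> \<in> U \<Longrightarrow> (\<Sum>\<gamma>\<in>F. \<phi> (moebius \<gamma> \<tau>)) = 1"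
proof -
  obtain A where A: "\<And>\<tau>. Im \<tau> > 0 \<Longrightarrow> \<exists>\<gamma>\<in>G. hyp_size (moebius \<gamma> \<tau>) < A" using cover by blast
  define bump where "bump \<tau> = (max 0 (A - hyp_size \<tau>))\<^sup>2" for \<tau>
  define S where "S \<tau> = (\<Sum>\<delta> | \<delta> \<in> G \<and> hyp_size (moebius \<delta> \<tau>) < A. bump (moebius \<delta> \<tau>))" for \<tau>
  \<comment> \<open>The margin \<open>1\<close> around the support of \<open>bump\<close> leaves room to differentiate at its boundary.\<close>
  define U where "U = {\<tau>. Im \<tau> > 0 \<and> hyp_size \<tau> < A + 1}"
  define F where "F = {\<gamma> \<in> G. \<exists>\<tau>. \<tau> \<in> hyp_ball (A + 1) \<and> moebius \<gamma> \<tau> \<in> hyp_ball (A + 1)}"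
  define \<phi> where "\<phi> \<tau> = (if \<tau> \<in> U then bump \<tau> / S \<tau> else 0)" for \<tau>
  have finF: "finite F" unfolding F_def by (rule finite_ball_overlaps)
  have openU: "open U" unfolding U_def by (rule open_hyp_size_less)
  have UH: "U \<subseteq> {\<tau>. Im \<tau> > 0}" by (auto simp: U_def)
  have memF: "\<gamma> \<in> F" if "\<gamma> \<in> G" "\<tau> \<in> U" "hyp_size (moebius \<gamma> \<tau>) < A + 1" for \<gamma> \<tau>
  proof -
    have "\<tau> \<in> hyp_ball (A + 1)" "moebius \<gamma> \<tau> \<in> hyp_ball (A + 1)"
      using that Im_moebius_pos[OF det[OF that(1)]] by (auto simp: U_def hyp_ball_def)
    then show ?thesis using that(1) by (auto simp: F_def)
  qed
  have SF: "S \<tau> = (\<Sum>\<gamma>\<in>F. bump (moebius \<gamma> \<tau>))" if "\<tau> \<in> U" for \<tau>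
    unfolding S_def
  proof (rule sum.mono_neutral_left[OF finF])
    show "{\<delta> \<in> G. hyp_size (moebius \<delta> \<tau>) < A} \<subseteq> F" using memF[OF _ that] by fastforce
    show "\<forall>\<gamma>\<in>F - {\<delta> \<in> G. hyp_size (moebius \<delta> \<tau>) < A}. bump (moebius \<gamma> \<tau>) = 0"
      by (auto simp: F_def bump_def)
  qed
  have Spos: "S \<tau> > 0" if \<tau>: "\<tau> \<in> U" for \<tau>
  proof -
    obtain \<gamma> where \<gamma>: "\<gamma> \<in> G" "hyp_size (moebius \<gamma> \<tau>) < A" using A UH \<tau> by blast
    have "\<gamma> \<in> F" using memF[OF \<gamma>(1) \<tau>] \<gamma>(2) by simp
    then show ?thesis unfolding SF[OF \<tau>]
      by (rule sum_pos2[OF finF]) (use \<gamma>(2) in \<open>auto simp: bump_def\<close>)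
  qed
  have Sinv: "S (moebius \<gamma> \<tau>) = S \<tau>" if "\<gamma> \<in> G" "Im \<tau> > 0" for \<gamma> \<tau>
    unfolding S_def
  proof (rule sum.reindex_bij_witness[where i="\<lambda>\<delta>. \<delta> ** adj2 \<gamma>" and j="\<lambda>\<delta>. \<delta> ** \<gamma>"])
    have m: "moebius (\<delta> ** \<gamma>) \<tau> = moebius \<delta> (moebius \<gamma> \<tau>)" for \<delta> :: "real^2^2"
      by (rule moebius_mult(2)[OF det[OF that(1)] that(2)])
    have a: "\<delta> ** \<gamma> ** adj2 \<gamma> = \<delta>" "\<delta> ** adj2 \<gamma> ** \<gamma> = \<delta>" for \<delta> :: "real^2^2"
      using adj2_mult[OF det[OF that(1)]] by (simp_all flip: matrix_mul_assoc)
    fix \<delta> :: "real^2^2"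
    show "\<delta> ** \<gamma> ** adj2 \<gamma> = \<delta>" "\<delta> ** adj2 \<gamma> ** \<gamma> = \<delta>" by (rule a)+
    show "\<delta> ** \<gamma> \<in> {\<delta> \<in> G. hyp_size (moebius \<delta> \<tau>) < A}" "bump (moebius (\<delta> ** \<gamma>) \<tau>) = bump (moebius \<delta> (moebius \<gamma> \<tau>))"
      if "\<delta> \<in> {\<delta> \<in> G. hyp_size (moebius \<delta> (moebius \<gamma> \<tau>)) < A}"
      using that mult[OF _ \<open>\<gamma> \<in> G\<close>] by (auto simp: m)
    show "\<delta> ** adj2 \<gamma> \<in> {\<delta> \<in> G. hyp_size (moebius \<delta> (moebius \<gamma> \<tau>)) < A}"
      if "\<delta> \<in> {\<delta> \<in> G. hyp_size (moebius \<delta> \<tau>) < A}"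
      using that mult[OF _ adj[OF \<open>\<gamma> \<in> G\<close>]] m[of "\<delta> ** adj2 \<gamma>"] by (auto simp: a)
  qed
  have C1bump: "C1_on {\<tau>. Im \<tau> > 0} bump"
  proof -
    have "C1_on {\<tau>. Im \<tau> > 0} (\<lambda>\<tau>. A + - hyp_size \<tau>)"
      by (intro C1_on_add C1_on_const C1_on_bounded_linear_compose[OF _ C1_on_hyp_size] bounded_linear_minus bounded_linear_ident)
    from C1_on_real_compose[OF this has_real_derivative_max_0_squared]
    show ?thesis by (simp add: bump_def[abs_def] continuous_intros)
  qed
  have C1S: "C1_on U S"
  proof (rule C1_on_cong[OF C1_on_sum openU SF[symmetric]])
    fix \<gamma> assume "\<gamma> \<in> F"
    then have d: "det \<gamma> = 1" using det by (simp add: F_def)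
    show "C1_on U (\<lambda>\<tau>. bump (moebius \<gamma> \<tau>))"
    proof (rule C1_on_holomorphic_compose[OF C1bump openU])
      show "moebius \<gamma> holomorphic_on U"
        using moebius_has_field_derivative[OF d] UH by (auto simp: holomorphic_on_open[OF openU])
      show "moebius \<gamma> ` U \<subseteq> {\<tau>. Im \<tau> > 0}" using Im_moebius_pos[OF d] UH by auto
    qed
  qed
  have \<phi>0: "\<phi> \<tau> = 0" if "\<tau> \<notin> hyp_ball A" for \<tau>
    using that by (auto simp: \<phi>_def U_def hyp_ball_def bump_def)
  have C1\<phi>: "C1_on UNIV \<phi>"
  proof -
    have "C1_on U (\<lambda>\<tau>. bump \<tau> * inverse (S \<tau>))"
      using Spos UH by (intro C1_on_mult C1_on_inverse C1S C1_on_subset[OF C1bump]) force+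
    then have "C1_on U \<phi>"
      by (rule C1_on_cong[OF _ openU]) (simp add: \<phi>_def divide_inverse)
    moreover have "C1_on (- hyp_ball A) \<phi>"
      by (rule C1_on_cong[OF C1_on_const[of _ 0]])
         (use \<phi>0 compact_hyp_ball in \<open>auto simp: open_Compl compact_imp_closed\<close>)
    moreover have "open (- hyp_ball A)" using compact_hyp_ball by (simp add: open_Compl compact_imp_closed)
    moreover have "U \<union> - hyp_ball A = UNIV" by (auto simp: U_def hyp_ball_def)
    ultimately show ?thesis using C1_on_Un[of U \<phi> "- hyp_ball A"] openU by simp
  qed
  have sum1: "(\<Sum>\<gamma>\<in>F. \<phi> (moebius \<gamma> \<tau>)) = 1" if "\<tau> \<in> U" for \<tau>
  proof -
    have "\<phi> (moebius \<gamma> \<tau>) = bump (moebius \<gamma> \<tau>) / S \<tau>" if "\<gamma> \<in> F" for \<gamma>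
    proof -
      have \<gamma>: "\<gamma> \<in> G" using that by (simp add: F_def)
      have "Im \<tau> > 0" using UH \<open>\<tau> \<in> U\<close> by auto
      then show ?thesis using Sinv[OF \<gamma>, of \<tau>] Im_moebius_pos[OF det[OF \<gamma>], of \<tau>]
        by (auto simp: \<phi>_def U_def bump_def)
    qed
    then have "(\<Sum>\<gamma>\<in>F. \<phi> (moebius \<gamma> \<tau>)) = (\<Sum>\<gamma>\<in>F. bump (moebius \<gamma> \<tau>) / S \<tau>)" by simp
    also have "\<dots> = (\<Sum>\<gamma>\<in>F. bump (moebius \<gamma> \<tau>)) / S \<tau>" by (simp only: sum_divide_distrib)
    also have "\<dots> = S \<tau> / S \<tau>" by (simp only: SF[OF that, symmetric])
    finally show ?thesis using Spos[OF that] by simp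
  qed
  have adjF: "adj2 \<gamma> \<in> F" if "\<gamma> \<in> F" for \<gamma>
  proof -
    obtain \<tau> where \<tau>: "\<gamma> \<in> G" "\<tau> \<in> hyp_ball (A + 1)" "moebius \<gamma> \<tau> \<in> hyp_ball (A + 1)"
      using \<open>\<gamma> \<in> F\<close> by (auto simp: F_def)
    have "moebius (adj2 \<gamma>) (moebius \<gamma> \<tau>) = \<tau>"
      using moebius_inverse(1)[of "adj2 \<gamma>" \<gamma> \<tau>] det[OF \<tau>(1)] adj2_mult(2) \<tau>(2) by (simp add: hyp_ball_def)
    then have "\<exists>\<sigma>. \<sigma> \<in> hyp_ball (A + 1) \<and> moebius (adj2 \<gamma>) \<sigma> \<in> hyp_ball (A + 1)" using \<tau> by metis
    then show ?thesis using adj[OF \<tau>(1)] by (simp add: F_def)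
  qed
  show ?thesis
  proof (rule that[OF C1\<phi> _ \<phi>0 _ finF _ _ openU _ UH sum1])
    show "\<phi> \<tau> \<ge> 0" for \<tau> using Spos[of \<tau>] by (auto simp: \<phi>_def bump_def)
    obtain \<gamma> where "\<gamma> \<in> G" "hyp_size (moebius \<gamma> \<i>) < A" using A[of \<i>] by auto
    then have "moebius \<gamma> \<i> \<in> hyp_ball A" using Im_moebius_pos[OF det, of \<gamma> \<i>] by (simp add: hyp_ball_def)
    then show "hyp_ball A \<noteq> {}" by auto
    show "F \<subseteq> G" by (auto simp: F_def)
    show "adj2 ` F = F" using adjF adj2_adj2 by (metis (no_types, lifting) image_eqI image_subsetI subsetI subset_antisym)
    show "hyp_ball A \<subseteq> U" by (auto simp: U_def hyp_ball_def)
  qed auto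
qed

end

section \<open>Quasimodular forms of weight two\<close>

context lifted_cocompact_group
begin

text \<open>
The weight two function \<open>E = g + \<i>/(2y)\<close> satisfies \<open>dbar E = 1 / (2 y^2)\<close>. Integrating
\<open>dbar (\<Phi> E)\<close> for the partition function \<open>\<Phi>\<close> gives \<open>\<integral> E dbar \<Phi> = - \<integral> \<Phi> / (2 y^2)\<close>, which is
negative. On the other hand, inserting \<open>1 = \<Sum> \<Phi>(\<gamma>\<tau>)\<close> and moving each \<open>\<gamma>\<close> to the other factor gives
\<open>\<integral> E dbar \<Phi> = \<integral> \<Phi> E dbar (\<Sum> \<Phi> \<circ> \<gamma>) = 0\<close>, because the sum is locally constant.
\<close>

theorem no_quasimodular_form:
  assumes hol: "g holomorphic_on {\<tau>. Im \<tau> > 0}"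
    and quasi: "\<And>\<gamma> \<tau>. \<gamma> \<in> G \<Longrightarrow> Im \<tau> > 0 \<Longrightarrow>
      g (moebius \<gamma> \<tau>) = (aut_factor \<gamma> \<tau>)\<^sup>2 * g \<tau> - of_real (\<gamma>$2$1) * aut_factor \<gamma> \<tau>"
  shows False
proof -
  obtain \<phi> F A U where \<phi>: "C1_on UNIV \<phi>" "\<And>\<tau>. \<phi> \<tau> \<ge> (0::real)" "\<And>\<tau>. \<tau> \<notin> hyp_ball A \<Longrightarrow> \<phi> \<tau> = 0"
    and ball: "hyp_ball A \<noteq> {}" and F: "finite F" "F \<subseteq> G" "adj2 ` F = F"
    and U: "open U" "hyp_ball A \<subseteq> U" "U \<subseteq> {\<tau>. Im \<tau> > 0}"
    and sum1: "\<And>\<tau>. \<tau> \<in> U \<Longrightarrow> (\<Sum>\<gamma>\<in>F. \<phi> (moebius \<gamma> \<tau>)) = 1"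
    by (rule invariant_partition_of_unity) (rule that, assumption+)
  note cball = compact_hyp_ball[of A]
  define \<Phi> where "\<Phi> \<tau> = complex_of_real (\<phi> \<tau>)" for \<tau>
  \<comment> \<open>The constant \<open>\<i>/2\<close> makes the defect \<open>-c j\<close> of \<open>g\<close> cancel against that of \<open>1/y\<close>, as \<open>cnj j = j - 2 \<i> c y\<close>.\<close>
  define E where "E \<tau> = g \<tau> + \<i> / 2 * of_real (inverse (Im \<tau>))" for \<tau>
  have C1\<Phi>: "C1_on UNIV \<Phi>"
    unfolding \<Phi>_def by (rule C1_on_bounded_linear_compose[OF bounded_linear_of_real \<phi>(1)])
  have \<Phi>0: "\<Phi> \<tau> = 0" if "\<tau> \<notin> hyp_ball A" for \<tau> using \<phi>(3)[OF that] by (simp add: \<Phi>_def)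
  have c\<Phi>: "continuous_on UNIV \<Phi>" by (rule C1_on_imp_continuous_on[OF C1\<Phi>])
  have cd\<Phi>: "continuous_on UNIV (dbar \<Phi>)" by (rule C1_on_imp_continuous_on_dbar[OF C1\<Phi>])
  have d\<Phi>0: "dbar \<Phi> \<tau> = 0" if "\<tau> \<notin> hyp_ball A" for \<tau>
    by (rule dbar_eq_0_outside_support[OF compact_imp_closed[OF cball] \<Phi>0 that])
  have D\<Phi>: "(\<Phi> has_derivative frechet_derivative \<Phi> (at \<tau>)) (at \<tau>)" for \<tau>
    using C1\<Phi> unfolding C1_on_def by (metis UNIV_I frechet_derivative_at)
  have C1E: "C1_on {\<tau>. Im \<tau> > 0} E" unfolding E_def
    by (intro C1_on_add C1_on_mult C1_on_const C1_on_holomorphic open_half_plane hol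
        C1_on_bounded_linear_compose[OF bounded_linear_of_real] C1_on_inverse C1_on_bounded_linear bounded_linear_Im) auto
  have dE: "\<exists>E'. (E has_derivative E') (at \<tau>)" and dbarE: "dbar E \<tau> = of_real (1 / (2 * (Im \<tau>)\<^sup>2))" if \<tau>: "Im \<tau> > 0" for \<tau>
  proof -
    obtain D where D: "(g has_field_derivative D) (at \<tau>)"
      using hol \<tau> by (auto simp: holomorphic_on_open[OF open_half_plane])
    have "((\<lambda>\<tau>. inverse (Im \<tau>)) has_derivative (\<lambda>h. - (inverse (Im \<tau>) * Im h * inverse (Im \<tau>)))) (at \<tau>)"
      using \<tau> by (intro Deriv.has_derivative_inverse bounded_linear_imp_has_derivative bounded_linear_Im) auto
    then have "((\<lambda>\<tau>. complex_of_real (inverse (Im \<tau>))) has_derivative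
        (\<lambda>h. of_real (- (inverse (Im \<tau>) * Im h * inverse (Im \<tau>))))) (at \<tau>)"
      by (rule bounded_linear.has_derivative[OF bounded_linear_of_real])
    then have d: "(E has_derivative (\<lambda>h. D * h + \<i> / 2 * of_real (- (inverse (Im \<tau>) * Im h * inverse (Im \<tau>))))) (at \<tau>)"
      unfolding E_def by (intro has_derivative_add has_derivative_mult_right D[unfolded has_field_derivative_def])
    show "\<exists>E'. (E has_derivative E') (at \<tau>)" using d by blast
    show "dbar E \<tau> = of_real (1 / (2 * (Im \<tau>)\<^sup>2))"
      unfolding dbar_eq[OF d] using \<tau> by (simp add: field_simps power2_eq_square)
  qed
  define Q where "Q \<tau> = (if Im \<tau> > 0 then E \<tau> * dbar \<Phi> \<tau> else 0)" for \<tau>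
  define p where "p \<tau> = (if Im \<tau> > 0 then \<phi> \<tau> / (2 * (Im \<tau>)\<^sup>2) else 0)" for \<tau>
  have Q0: "Q \<tau> = 0" if "\<tau> \<notin> hyp_ball A" for \<tau> using d\<Phi>0[OF that] by (simp add: Q_def)
  have p0: "p \<tau> = 0" if "\<tau> \<notin> hyp_ball A" for \<tau> using \<phi>(3)[OF that] by (simp add: p_def)
  have "continuous_on {\<tau>. Im \<tau> > 0} (\<lambda>\<tau>. E \<tau> * dbar \<Phi> \<tau>)"
    by (intro continuous_intros C1_on_imp_continuous_on C1E continuous_on_subset[OF cd\<Phi>]) auto
  then have "continuous_on {\<tau>. Im \<tau> > 0} Q" by (rule continuous_on_eq) (simp add: Q_def)
  then have cQ: "continuous_on UNIV Q" by (rule continuous_on_zero_extension[OF _ Q0])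
  have "continuous_on {\<tau>. Im \<tau> > 0} (\<lambda>\<tau>. \<phi> \<tau> / (2 * (Im \<tau>)\<^sup>2))"
    by (intro continuous_intros continuous_on_subset[OF C1_on_imp_continuous_on[OF \<phi>(1)]]) auto
  then have "continuous_on {\<tau>. Im \<tau> > 0} p" by (rule continuous_on_eq) (simp add: p_def)
  then have cp: "continuous_on UNIV p" by (rule continuous_on_zero_extension[OF _ p0])
  \<comment> \<open>Integration by parts: \<open>dbar (\<Phi> E) = Q + p\<close>.\<close>
  have stokes: "plane_integral Q + plane_integral (\<lambda>\<tau>. of_real (p \<tau>)) = 0"
  proof -
    have "C1_on {\<tau>. Im \<tau> > 0} (\<lambda>\<tau>. \<Phi> \<tau> * E \<tau>)"
      by (intro C1_on_mult C1E C1_on_subset[OF C1\<Phi>]) auto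
    then have "C1_on UNIV (\<lambda>\<tau>. \<Phi> \<tau> * E \<tau>)" by (rule C1_on_zero_extension[where A=A]) (simp add: \<Phi>0)
    then have "plane_integral (dbar (\<lambda>\<tau>. \<Phi> \<tau> * E \<tau>)) = 0"
      by (rule plane_integral_dbar_eq_0[OF _ cball]) (simp add: \<Phi>0)
    moreover have "dbar (\<lambda>\<tau>. \<Phi> \<tau> * E \<tau>) = (\<lambda>\<tau>. Q \<tau> + of_real (p \<tau>))"
    proof
      fix \<tau>
      show "dbar (\<lambda>\<tau>. \<Phi> \<tau> * E \<tau>) \<tau> = Q \<tau> + of_real (p \<tau>)"
      proof (cases "Im \<tau> > 0")
        case True
        obtain E' where "(E has_derivative E') (at \<tau>)" using dE[OF True] by blast
        from dbar_mult[OF D\<Phi> this] show ?thesis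
          using True by (simp add: dbarE Q_def p_def \<Phi>_def)
      next
        case False
        then have "\<tau> \<notin> hyp_ball A" by (simp add: hyp_ball_def)
        then show ?thesis
          using dbar_eq_0_outside_support[OF compact_imp_closed[OF cball], of "\<lambda>\<tau>. \<Phi> \<tau> * E \<tau>" \<tau>]
          by (simp add: \<Phi>0 Q0 p0)
      qed
    qed
    moreover have "plane_integral (\<lambda>\<tau>. Q \<tau> + of_real (p \<tau>)) = plane_integral Q + plane_integral (\<lambda>\<tau>. of_real (p \<tau>))"
      by (rule plane_integral_add; rule plane_integrable[OF _ cball])
         (use cQ Q0 cp p0 in \<open>auto intro!: continuous_intros\<close>)
    ultimately show ?thesis by simp
  qed
  have E_inv: "E (moebius \<gamma> \<tau>) = (aut_factor \<gamma> \<tau>)\<^sup>2 * E \<tau>" if "\<gamma> \<in> G" "Im \<tau> > 0" for \<gamma> \<tau>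
  proof -
    define j where "j = aut_factor \<gamma> \<tau>"
    have "inverse (Im (moebius \<gamma> \<tau>)) = (norm j)\<^sup>2 / Im \<tau>"
      by (simp add: Im_moebius[OF det[OF that(1)] that(2)] j_def)
    then have I1: "complex_of_real (inverse (Im (moebius \<gamma> \<tau>))) = j * cnj j / of_real (Im \<tau>)"
      by (simp only: of_real_divide complex_norm_square[symmetric])
    have I2: "cnj j = j - 2 * \<i> * of_real (\<gamma>$2$1) * of_real (Im \<tau>)"
      by (simp add: j_def aut_factor_def complex_eq_iff)
    have "\<i> / 2 * complex_of_real (inverse (Im (moebius \<gamma> \<tau>))) =
        j\<^sup>2 * (\<i> / 2 * of_real (inverse (Im \<tau>))) + of_real (\<gamma>$2$1) * j"
      unfolding I1 I2 using that(2) by (simp add: field_simps power2_eq_square)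
    then show ?thesis
      unfolding E_def quasi[OF that] j_def[symmetric] by (simp add: algebra_simps)
  qed
  \<comment> \<open>\<open>R\<close> and \<open>P\<close> are the integrand of one unfolded term before and after substituting \<open>\<gamma>\<tau>\<close> for \<open>\<sigma>\<close>.\<close>
  define R where "R \<gamma> \<sigma> = (if Im \<sigma> > 0 then \<Phi> (moebius (adj2 \<gamma>) \<sigma>) * Q \<sigma> else 0)" for \<gamma> \<sigma>
  define P where "P \<gamma> \<tau> = (if Im \<tau> > 0 then R \<gamma> (moebius \<gamma> \<tau>) / of_real (norm (aut_factor \<gamma> \<tau>) ^ 4) else 0)" for \<gamma> \<tau>
  have R0: "R \<gamma> \<sigma> = 0" if "\<sigma> \<notin> hyp_ball A" for \<gamma> \<sigma> using Q0[OF that] by (simp add: R_def)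
  have cR: "continuous_on UNIV (R \<gamma>)" if "\<gamma> \<in> F" for \<gamma>
  proof (rule continuous_on_zero_extension[OF _ R0])
    have d: "det (adj2 \<gamma>) = 1" using det that F(2) by auto
    have "continuous_on {\<tau>. Im \<tau> > 0} (\<lambda>\<sigma>. \<Phi> (moebius (adj2 \<gamma>) \<sigma>) * Q \<sigma>)"
      by (intro continuous_intros continuous_on_compose2[OF c\<Phi> continuous_on_moebius[OF d]] continuous_on_subset[OF cQ]) auto
    then show "continuous_on {\<tau>. Im \<tau> > 0} (R \<gamma>)" by (rule continuous_on_eq) (simp add: R_def)
  qed
  have P_eq: "P \<gamma> \<tau> = \<Phi> \<tau> * E \<tau> * dbar (\<lambda>\<tau>. \<Phi> (moebius \<gamma> \<tau>)) \<tau>" if "\<gamma> \<in> F" "Im \<tau> > 0" for \<gamma> \<tau>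
  proof -
    have \<gamma>: "\<gamma> \<in> G" using that F(2) by auto
    note d = det[OF \<gamma>]
    define j where "j = aut_factor \<gamma> \<tau>"
    have j0: "j \<noteq> 0" using aut_factor_nonzero[OF d that(2)] by (simp add: j_def)
    have "moebius (adj2 \<gamma>) (moebius \<gamma> \<tau>) = \<tau>"
      using moebius_inverse(1)[of "adj2 \<gamma>" \<gamma> \<tau>] d adj2_mult(2) that(2) by simp
    then have "R \<gamma> (moebius \<gamma> \<tau>) = \<Phi> \<tau> * (j\<^sup>2 * E \<tau> * dbar \<Phi> (moebius \<gamma> \<tau>))"
      using Im_moebius_pos[OF d that(2)] by (simp add: R_def Q_def E_inv[OF \<gamma> that(2)] j_def)
    moreover have "dbar (\<lambda>\<tau>. \<Phi> (moebius \<gamma> \<tau>)) \<tau> = cnj (inverse (j\<^sup>2)) * dbar \<Phi> (moebius \<gamma> \<tau>)"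
      using dbar_compose_holomorphic[OF moebius_has_field_derivative[OF d that(2)] D\<Phi>] by (simp add: j_def)
    moreover have "complex_of_real (norm j ^ 4) = j\<^sup>2 * cnj (j\<^sup>2)"
    proof -
      have "norm j ^ 4 = (norm (j\<^sup>2))\<^sup>2" by (simp add: norm_power flip: power_mult)
      then show ?thesis by (simp only: complex_norm_square)
    qed
    ultimately show ?thesis
      using that(2) j0 by (simp add: P_def j_def[symmetric] field_simps)
  qed
  have P0: "P \<gamma> \<tau> = 0" if "\<gamma> \<in> F" "\<tau> \<notin> hyp_ball A" for \<gamma> \<tau>
    using P_eq[OF that(1), of \<tau>] \<Phi>0[OF that(2)] by (cases "Im \<tau> > 0") (auto simp: P_def)
  have cP: "continuous_on UNIV (P \<gamma>)" if "\<gamma> \<in> F" for \<gamma>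
  proof (rule continuous_on_zero_extension[OF _ P0[OF that]])
    have d: "det \<gamma> = 1" using det that F(2) by auto
    have "continuous_on {\<tau>. Im \<tau> > 0} (aut_factor \<gamma>)"
      unfolding aut_factor_def by (intro continuous_intros)
    then have "continuous_on {\<tau>. Im \<tau> > 0} (\<lambda>\<tau>. R \<gamma> (moebius \<gamma> \<tau>) / of_real (norm (aut_factor \<gamma> \<tau>) ^ 4))"
      using aut_factor_nonzero[OF d]
      by (intro continuous_intros continuous_on_compose2[OF cR[OF that] continuous_on_moebius[OF d]]) auto
    then show "continuous_on {\<tau>. Im \<tau> > 0} (P \<gamma>)" by (rule continuous_on_eq) (simp add: P_def)
  qed
  \<comment> \<open>On the support of \<open>\<Phi>\<close> the sum of the translates is constant near \<open>\<tau>\<close>, so its derivative vanishes.\<close>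
  have sumP: "(\<Sum>\<gamma>\<in>F. P \<gamma> \<tau>) = 0" for \<tau>
  proof (cases "\<tau> \<in> hyp_ball A")
    case False
    then show ?thesis using P0 by simp
  next
    case True
    then have \<tau>: "\<tau> \<in> U" "Im \<tau> > 0" using U by auto
    define H where "H \<gamma> = frechet_derivative (\<lambda>\<tau>. \<Phi> (moebius \<gamma> \<tau>)) (at \<tau>)" for \<gamma>
    have H: "((\<lambda>\<tau>. \<Phi> (moebius \<gamma> \<tau>)) has_derivative H \<gamma>) (at \<tau>)" if "\<gamma> \<in> F" for \<gamma>
    proof -
      have "det \<gamma> = 1" using det that F(2) by auto
      from has_derivative_compose[OF moebius_has_field_derivative[OF this \<tau>(2), unfolded has_field_derivative_def] D\<Phi>]
      show ?thesis unfolding H_def by (metis frechet_derivative_at)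
    qed
    have "((\<lambda>\<tau>. \<Sum>\<gamma>\<in>F. \<Phi> (moebius \<gamma> \<tau>)) has_derivative (\<lambda>h. \<Sum>\<gamma>\<in>F. H \<gamma> h)) (at \<tau>)"
      by (rule has_derivative_sum[OF H])
    moreover have "((\<lambda>\<tau>. \<Sum>\<gamma>\<in>F. \<Phi> (moebius \<gamma> \<tau>)) has_derivative (\<lambda>_. 0)) (at \<tau>)"
      by (rule has_derivative_transform_within_open[of "\<lambda>_. 1" _ _ _ U])
         (use U \<tau> sum1 in \<open>auto simp: \<Phi>_def simp flip: of_real_sum\<close>)
    ultimately have "(\<lambda>h. \<Sum>\<gamma>\<in>F. H \<gamma> h) = (\<lambda>_. 0)" by (rule has_derivative_unique)
    then have "(\<Sum>\<gamma>\<in>F. H \<gamma> 1) = 0" "(\<Sum>\<gamma>\<in>F. H \<gamma> \<i>) = 0" by metis+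
    then have "(\<Sum>\<gamma>\<in>F. dbar (\<lambda>\<tau>. \<Phi> (moebius \<gamma> \<tau>)) \<tau>) = 0"
      by (simp add: dbar_def H_def sum.distrib flip: sum_distrib_left)
    then show ?thesis using P_eq[OF _ \<tau>(2)] by (simp flip: sum_distrib_left)
  qed
  \<comment> \<open>Closure of \<open>F\<close> under inverses turns the sum over \<open>\<gamma>^(-1)\<close> into the partition of unity.\<close>
  have sumR: "(\<Sum>\<gamma>\<in>F. R \<gamma> \<sigma>) = Q \<sigma>" for \<sigma>
  proof (cases "\<sigma> \<in> hyp_ball A")
    case False
    then show ?thesis using R0 Q0 by simp
  next
    case True
    then have \<sigma>: "\<sigma> \<in> U" "Im \<sigma> > 0" using U by auto
    have "(\<Sum>\<gamma>\<in>F. \<phi> (moebius (adj2 \<gamma>) \<sigma>)) = (\<Sum>\<gamma>\<in>adj2 ` F. \<phi> (moebius \<gamma> \<sigma>))"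
      by (subst sum.reindex) (auto intro: inj_on_inverseI[of _ adj2])
    also have "\<dots> = 1" using sum1[OF \<sigma>(1)] F(3) by simp
    finally have "(\<Sum>\<gamma>\<in>F. \<Phi> (moebius (adj2 \<gamma>) \<sigma>)) = 1" unfolding \<Phi>_def by (metis of_real_1 of_real_sum)
    then show ?thesis using \<sigma>(2) by (simp add: R_def flip: sum_distrib_right)
  qed
  have "plane_integral Q = plane_integral (\<lambda>\<sigma>. \<Sum>\<gamma>\<in>F. R \<gamma> \<sigma>)" by (simp add: sumR)
  also have "\<dots> = (\<Sum>\<gamma>\<in>F. plane_integral (R \<gamma>))"
    by (rule plane_integral_sum[OF F(1) cR cball R0])
  also have "\<dots> = (\<Sum>\<gamma>\<in>F. plane_integral (P \<gamma>))"
  proof (rule sum.cong[OF refl])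
    fix \<gamma> assume \<gamma>: "\<gamma> \<in> F"
    have "hyp_ball A \<subseteq> upper_half_plane" using hyp_ball_subset by (auto simp: upper_half_plane_def)
    from plane_integral_moebius[OF _ cR[OF \<gamma>] cball this R0, of \<gamma>]
    show "plane_integral (R \<gamma>) = plane_integral (P \<gamma>)" using det \<gamma> F(2) unfolding P_def by (metis subsetD)
  qed
  also have "\<dots> = plane_integral (\<lambda>\<tau>. \<Sum>\<gamma>\<in>F. P \<gamma> \<tau>)"
    by (rule plane_integral_sum[OF F(1) cP cball P0, symmetric])
  also have "\<dots> = 0" by (simp add: sumP plane_integral_def)
  finally have "plane_integral (\<lambda>\<tau>. of_real (p \<tau>)) = 0" using stokes by simp
  moreover have "p \<tau> \<ge> 0" for \<tau> by (simp add: p_def \<phi>(2))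
  ultimately have p_zero: "p \<tau> = 0" for \<tau>
    using plane_integral_nonneg_eq_0[OF cp cball p0] by blast
  obtain \<tau> where \<tau>: "\<tau> \<in> hyp_ball A" using ball by blast
  then have "Im \<tau> > 0" by (simp add: hyp_ball_def)
  have "\<phi> (moebius \<gamma> \<tau>) = 0" if "\<gamma> \<in> F" for \<gamma>
  proof -
    have "det \<gamma> = 1" using that F(2) det by blast
    then show ?thesis
      using p_zero[of "moebius \<gamma> \<tau>"] Im_moebius_pos[of \<gamma> \<tau>] \<open>Im \<tau> > 0\<close> by (simp add: p_def)
  qed
  then have "(\<Sum>\<gamma>\<in>F. \<phi> (moebius \<gamma> \<tau>)) = 0" by (simp add: sum.neutral)
  then show False using sum1 \<tau> U(2) by auto
qed

end

section \<open>Components and operators of a quasi-vertex operator algebra\<close>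

lemma linear_op_iff:
  assumes "vector_space s"
  shows "Vector_Spaces.linear s s f \<longleftrightarrow> (\<forall>x y. f (x + y) = f x + f y) \<and> (\<forall>c x. f (s c x) = s c (f x))"
proof -
  interpret vector_space s by (rule assms)
  show ?thesis by (simp add: linear_iff_module_hom module_hom_iff module_axioms)
qed

lemma Sum_any_eq_sum: "finite A \<Longrightarrow> (\<And>a. a \<notin> A \<Longrightarrow> f a = 0) \<Longrightarrow> Sum_any f = sum f A"
  by (rule Sum_any.expand_superset) auto

sublocale quasi_vertex_operator_algebra \<subseteq> vs: vector_space "scl V"
  by (rule vector_space)

context quasi_vertex_operator_algebra
begin

text \<open>
Linear functionals separate vectors. They reduce statements about vector-valued functions to scalar function theory.
\<close>

lemma linear_functional_exists:
  assumes "w \<noteq> 0"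
  obtains \<phi> where "Vector_Spaces.linear (scl V) ((*) :: complex \<Rightarrow> _) \<phi>" "\<phi> w = (1 :: complex)"
proof -
  interpret C: vector_space "(*) :: complex \<Rightarrow> complex \<Rightarrow> complex"
    by unfold_locales (auto simp: algebra_simps)
  interpret vector_space_pair "scl V" "(*) :: complex \<Rightarrow> complex \<Rightarrow> complex" ..
  have "vs.independent {w}" using assms by (simp add: vs.independent_insert)
  then obtain g where "Vector_Spaces.linear (scl V) (*) g" "\<forall>x\<in>{w}. g x = (1::complex)"
    using linear_independent_extend[of "{w}" "\<lambda>_. 1"] by auto
  then show ?thesis using that by auto
qed

lemma wt_zero: "0 \<in> wt V n" using wt_subspace by (rule vs.subspace_0)
lemma wt_add: "x \<in> wt V n \<Longrightarrow> y \<in> wt V n \<Longrightarrow> x + y \<in> wt V n" using wt_subspace by (rule vs.subspace_add)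
lemma wt_scale: "x \<in> wt V n \<Longrightarrow> scl V c x \<in> wt V n" using wt_subspace by (rule vs.subspace_scale)

lemma is_decomposition_component: "is_decomposition V v (\<lambda>n. component V n v)"
  unfolding component_def by (rule theI'[OF direct_sum])

lemma component_unique: "is_decomposition V v x \<Longrightarrow> component V n v = x n"
  using direct_sum is_decomposition_component by metis

lemma component_wt: "component V n v \<in> wt V n"
  and finite_components: "finite {n. component V n v \<noteq> 0}"
  and Sum_component: "Sum_any (\<lambda>n. component V n v) = v"
  using is_decomposition_component[of v] unfolding is_decomposition_def by auto

lemma sum_component:
  assumes "finite A" "\<And>n. n \<notin> A \<Longrightarrow> component V n v = 0"
  shows "(\<Sum>n\<in>A. component V n v) = v"
  using Sum_any_eq_sum[OF assms] Sum_component[of v] by simp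

lemma component_eqI:
  assumes "\<And>n. component V n v = component V n w"
  shows "v = w"
  using arg_cong[where f=Sum_any, OF ext[of "\<lambda>n. component V n v" "\<lambda>n. component V n w"], OF assms]
  by (simp only: Sum_component)

lemma component_add: "component V n (v + w) = component V n v + component V n w"
proof (rule component_unique)
  show "is_decomposition V (v + w) (\<lambda>n. component V n v + component V n w)"
    unfolding is_decomposition_def
  proof (intro conjI allI)
    show "finite {n. component V n v + component V n w \<noteq> 0}"
      by (rule finite_subset[OF _ finite_UnI[OF finite_components[of v] finite_components[of w]]]) auto
    show "v + w = (\<Sum>n. component V n v + component V n w)"
      by (subst Sum_any.distrib) (simp_all add: finite_components Sum_component)
  qed (intro wt_add component_wt)
qed

lemma scl_Sum_any: "finite {n. f n \<noteq> 0} \<Longrightarrow> scl V c (Sum_any f) = Sum_any (\<lambda>n. scl V c (f n))"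
  by (subst (1 2) Sum_any_eq_sum[of "{n. f n \<noteq> 0}"]) (auto simp: vs.scale_sum_right)

lemma component_scale: "component V n (scl V c v) = scl V c (component V n v)"
proof (rule component_unique)
  show "is_decomposition V (scl V c v) (\<lambda>n. scl V c (component V n v))"
    unfolding is_decomposition_def
  proof (intro conjI allI)
    show "finite {n. scl V c (component V n v) \<noteq> 0}"
      by (rule finite_subset[OF _ finite_components[of v]]) auto
    show "scl V c v = (\<Sum>n. scl V c (component V n v))"
      using scl_Sum_any[OF finite_components, of c v] by (simp add: Sum_component)
  qed (intro wt_scale component_wt)
qed

lemma component_linear: "linear_op V (component V n)"
  by (simp add: linear_op_iff[OF vector_space] component_add component_scale)

lemma component_zero [simp]: "component V n 0 = 0"
  using component_scale[of n 0 0] by simp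

lemma component_sum: "component V n (sum f A) = (\<Sum>a\<in>A. component V n (f a))"
  by (induction A rule: infinite_finite_induct) (simp_all add: component_add)

lemma component_of_wt:
  assumes "v \<in> wt V m"
  shows "component V n v = (if n = m then v else 0)"
proof (rule component_unique)
  show "is_decomposition V v (\<lambda>n. if n = m then v else 0)"
    using assms wt_zero by (auto simp: is_decomposition_def)
qed

subsection \<open>The operator \<open>L(1)\<close>\<close>

lemma L_add: "m \<in> {-1, 0, 1} \<Longrightarrow> Lop V m (x + y) = Lop V m x + Lop V m y"
  and L_scale: "m \<in> {-1, 0, 1} \<Longrightarrow> Lop V m (scl V c x) = scl V c (Lop V m x)"
  using Lop_linear linear_op_iff[OF vector_space] by blast+

lemma L_zero: "m \<in> {-1, 0, 1} \<Longrightarrow> Lop V m 0 = 0"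
  using L_scale[of m 0 0] by simp

lemma L_sum: "m \<in> {-1, 0, 1} \<Longrightarrow> Lop V m (sum f A) = (\<Sum>a\<in>A. Lop V m (f a))"
  by (induction A rule: infinite_finite_induct) (simp_all add: L_add L_zero)

lemma L0_component: "component V n (Lop V 0 v) = scl V (of_int n) (component V n v)"
proof -
  let ?A = "{n. component V n v \<noteq> 0}"
  have "Lop V 0 v = Lop V 0 (\<Sum>m\<in>?A. component V m v)"
    by (subst sum_component) (auto intro: finite_components)
  also have "\<dots> = (\<Sum>m\<in>?A. scl V (of_int m) (component V m v))"
    by (simp add: L_sum L0_wt[OF component_wt])
  finally have "component V n (Lop V 0 v) = (\<Sum>m\<in>?A. scl V (of_int m) (component V n (component V m v)))"
    by (simp add: component_sum component_scale)
  also have "\<dots> = (\<Sum>m\<in>?A. if n = m then scl V (of_int n) (component V n v) else 0)"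
    by (intro sum.cong) (auto simp: component_of_wt[OF component_wt])
  also have "\<dots> = scl V (of_int n) (component V n v)"
    using finite_components by (simp add: sum.delta)
  finally show ?thesis .
qed

text \<open>
The component of weight \<open>m\<close> is multiplied by \<open>m\<close>, so only the component whose weight is the eigenvalue survives.
\<close>

lemma wt_if_L0_eigenvector:
  assumes "Lop V 0 v = scl V (of_int n) v"
  shows "v \<in> wt V n"
proof -
  have "component V m v = component V m (component V n v)" for m
  proof (cases "m = n")
    case False
    have "scl V (of_int m) (component V m v) = scl V (of_int n) (component V m v)"
      using arg_cong[OF assms, of "component V m"] by (simp add: L0_component component_scale)
    then have "component V m v = 0" using False by simp
    then show ?thesis using False by (simp add: component_of_wt[OF component_wt])
  qed (simp add: component_of_wt[OF component_wt])
  then have "v = component V n v" by (rule component_eqI)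
  then show ?thesis using component_wt by metis
qed

text \<open>
The relation \<open>[L(1), L(0)] = L(1)\<close> lowers the eigenvalue of \<open>L(0)\<close> by one.
\<close>

lemma L1_wt:
  assumes "v \<in> wt V n"
  shows "Lop V 1 v \<in> wt V (n - 1)"
proof (rule wt_if_L0_eigenvector)
  have "Lop V 1 (Lop V 0 v) - Lop V 0 (Lop V 1 v) = Lop V 1 v"
    using Lop_commutator[of 1 0 v] by simp
  then have "Lop V 0 (Lop V 1 v) = scl V (of_int n) (Lop V 1 v) - Lop V 1 v"
    by (simp add: L0_wt[OF assms] L_scale algebra_simps)
  then show "Lop V 0 (Lop V 1 v) = scl V (of_int (n - 1)) (Lop V 1 v)"
    by (simp add: vs.scale_left_diff_distrib)
qed

lemma component_L1: "component V n (Lop V 1 v) = Lop V 1 (component V (n + 1) v)"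
proof -
  let ?A = "{n. component V n v \<noteq> 0}"
  have "Lop V 1 v = Lop V 1 (\<Sum>m\<in>?A. component V m v)"
    by (subst sum_component) (auto intro: finite_components)
  also have "\<dots> = (\<Sum>m\<in>?A. Lop V 1 (component V m v))" by (simp add: L_sum)
  finally have "component V n (Lop V 1 v) = (\<Sum>m\<in>?A. component V n (Lop V 1 (component V m v)))"
    by (simp add: component_sum)
  also have "\<dots> = (\<Sum>m\<in>?A. if n + 1 = m then Lop V 1 (component V (n + 1) v) else 0)"
    by (intro sum.cong) (auto simp: component_of_wt[OF L1_wt[OF component_wt]])
  also have "\<dots> = Lop V 1 (component V (n + 1) v)"
    using finite_components by (auto simp: sum.delta L_zero)
  finally show ?thesis .
qed

lemma L1_pow_zero [simp]: "(Lop V 1 ^^ m) 0 = 0"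
  by (induction m) (simp_all add: L_zero)

lemma L1_pow_scale: "(Lop V 1 ^^ m) (scl V c v) = scl V c ((Lop V 1 ^^ m) v)"
  by (induction m) (simp_all add: L_scale)

lemma L1_pow_sum: "(Lop V 1 ^^ m) (sum f A) = (\<Sum>a\<in>A. (Lop V 1 ^^ m) (f a))"
  by (induction m) (simp_all add: L_sum)

lemma component_L1_pow: "component V n ((Lop V 1 ^^ m) v) = (Lop V 1 ^^ m) (component V (n + int m) v)"
  by (induction m arbitrary: n) (simp_all add: component_L1 algebra_simps)

text \<open>
Only finitely many weights occur in a vector, and there are none below some bound.
\<close>

lemma L1_nilpotent: "\<exists>M. \<forall>m\<ge>M. (Lop V 1 ^^ m) v = 0"
proof -
  obtain N where N: "\<And>n. n < N \<Longrightarrow> wt V n = {0}" using wt_bounded_below by blast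
  obtain B where B: "\<And>n. component V n v \<noteq> 0 \<Longrightarrow> n \<le> B"
    using bdd_above_finite[OF finite_components[of v]] by (auto simp: bdd_above_def)
  have "(Lop V 1 ^^ m) v = 0" if "nat (B - N) + 1 \<le> m" for m
  proof (rule component_eqI)
    fix n
    show "component V n ((Lop V 1 ^^ m) v) = component V n 0"
    proof (cases "n < N")
      case True
      then show ?thesis using N component_wt[of n] by auto
    next
      case False
      then have "component V (n + int m) v = 0" using B[of "n + int m"] that by linarith
      then show ?thesis by (simp add: component_L1_pow)
    qed
  qed
  then show ?thesis by blast
qed

subsection \<open>The automorphy operator\<close>

lemma exp_L1_eq_sum:
  assumes "\<And>m. m \<ge> M \<Longrightarrow> (Lop V 1 ^^ m) v = 0"
  shows "exp_L1 V x v = (\<Sum>m<M. scl V (x ^ m / fact m) ((Lop V 1 ^^ m) v))"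
  unfolding exp_L1_def by (rule Sum_any_eq_sum) (use assms in auto)

text \<open>
All sums are finite by local nilpotency, so the coefficient of \<open>L(1)^p\<close> in the product is the coefficient
\<open>(x + (-x))^p / p!\<close> of the exponential series of zero.
\<close>

lemma exp_L1_inverse: "exp_L1 V x (exp_L1 V (- x) v) = v"
proof -
  obtain M0 where M0: "\<And>m. m \<ge> M0 \<Longrightarrow> (Lop V 1 ^^ m) v = 0" using L1_nilpotent[of v] by blast
  \<comment> \<open>The successor guarantees that the summand for \<open>p = 0\<close> occurs.\<close>
  define M where "M = Suc M0"
  have M: "(Lop V 1 ^^ m) v = 0" if "m \<ge> M" for m using M0 that by (simp add: M_def)
  let ?c = "\<lambda>x m. x ^ m / fact m :: complex"
  define w where "w = exp_L1 V (- x) v"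
  have w: "w = (\<Sum>l<M. scl V (?c (- x) l) ((Lop V 1 ^^ l) v))"
    unfolding w_def by (rule exp_L1_eq_sum[OF M])
  have Lw: "(Lop V 1 ^^ m) w = (\<Sum>l<M. scl V (?c (- x) l) ((Lop V 1 ^^ (m + l)) v))" for m
    unfolding w L1_pow_sum L1_pow_scale by (simp add: funpow_add)
  have "exp_L1 V x w = (\<Sum>m<M. scl V (?c x m) ((Lop V 1 ^^ m) w))"
    by (rule exp_L1_eq_sum) (simp add: Lw M)
  also have "\<dots> = (\<Sum>m<M. \<Sum>l<M. scl V (?c x m * ?c (- x) l) ((Lop V 1 ^^ (m + l)) v))"
    unfolding Lw by (simp add: vs.scale_sum_right)
  also have "\<dots> = (\<Sum>(m,l)\<in>{..<M} \<times> {..<M}. scl V (?c x m * ?c (- x) l) ((Lop V 1 ^^ (m + l)) v))"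
    by (simp add: sum.cartesian_product)
  also have "\<dots> = (\<Sum>(m,l)\<in>{(m,l). m + l < M}. scl V (?c x m * ?c (- x) l) ((Lop V 1 ^^ (m + l)) v))"
    by (rule sum.mono_neutral_right) (auto, metis M not_less)
  also have "\<dots> = (\<Sum>p<M. \<Sum>m\<le>p. scl V (?c x m * ?c (- x) (p - m)) ((Lop V 1 ^^ (m + (p - m))) v))"
    by (rule sum.triangle_reindex)
  also have "\<dots> = (\<Sum>p<M. scl V (\<Sum>m\<le>p. ?c x m * ?c (- x) (p - m)) ((Lop V 1 ^^ p) v))"
    by (intro sum.cong refl) (simp add: vs.scale_sum_left)
  also have "\<dots> = (\<Sum>p<M. scl V (if p = 0 then 1 else 0) ((Lop V 1 ^^ p) v))"
  proof (intro sum.cong refl arg_cong2[where f="scl V"])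
    fix p
    have "(\<Sum>m\<le>p. ?c x m * ?c (- x) (p - m)) = ?c (x + - x) p"
      using exp_series_add_commuting[of x "- x" p] by (simp add: scaleR_conv_of_real divide_inverse mult.commute)
    then show "(\<Sum>m\<le>p. ?c x m * ?c (- x) (p - m)) = (if p = 0 then 1 else 0)" by simp
  qed
  also have "\<dots> = (\<Sum>p<M. if p = 0 then v else 0)"
    by (intro sum.cong) auto
  also have "\<dots> = v" by (simp add: M_def)
  finally show ?thesis by (simp add: w_def)
qed

lemma component_pow_L0: "component V n (pow_L0 V x e v) = scl V (x powi (e * n)) (component V n v)"
proof (rule component_unique)
  show "is_decomposition V (pow_L0 V x e v) (\<lambda>n. scl V (x powi (e * n)) (component V n v))"
    unfolding is_decomposition_def pow_L0_def
  proof (intro conjI allI)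
    show "finite {n. scl V (x powi (e * n)) (component V n v) \<noteq> 0}"
      by (rule finite_subset[OF _ finite_components[of v]]) auto
  qed (intro wt_scale component_wt, rule refl)
qed

lemma pow_L0_inverse:
  assumes "x \<noteq> 0"
  shows "pow_L0 V x e (pow_L0 V x (- e) v) = v"
proof (rule component_eqI)
  fix n
  have "x powi (e * n) * x powi (- e * n) = 1"
    using assms power_int_add[of x "e * n" "- e * n"] by simp
  then show "component V n (pow_L0 V x e (pow_L0 V x (- e) v)) = component V n v"
    by (simp only: component_pow_L0 vs.scale_scale vs.scale_one)
qed

lemma bij_exp_L1: "bij (exp_L1 V x)"
proof -
  have "exp_L1 V (- x) (exp_L1 V x v) = v" for v
    using exp_L1_inverse[of "- x" v] by (simp only: minus_minus)
  then show ?thesis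
    using exp_L1_inverse[of x] by (rule bij_betw_byWitness[OF ballI ballI subset_UNIV subset_UNIV])
qed

lemma bij_pow_L0:
  assumes "x \<noteq> 0"
  shows "bij (pow_L0 V x e)"
proof -
  have "pow_L0 V x (- e) (pow_L0 V x e v) = v" for v
    using pow_L0_inverse[OF assms, of "- e" v] by (simp only: minus_minus)
  then show ?thesis
    using pow_L0_inverse[OF assms, of e] by (rule bij_betw_byWitness[OF ballI ballI subset_UNIV subset_UNIV])
qed

text \<open>
Invertibility lets the defining condition of a modular form, which is stated with \<open>K^(-1)\<close>, be solved for the value at
\<open>\<gamma>\<tau>\<close>.
\<close>

lemma bij_Kop:
  assumes "aut_factor \<gamma> \<tau> \<noteq> 0"
  shows "bij (Kop V \<gamma> \<tau>)"
proof -
  have "Kop V \<gamma> \<tau> = exp_L1 V (- (of_real (\<gamma>$2$1) * aut_factor \<gamma> \<tau>)) \<circ> pow_L0 V (aut_factor \<gamma> \<tau>) (- 2)"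
    by (rule ext) (simp only: Kop_def o_apply)
  then show ?thesis using bij_comp[OF bij_pow_L0[OF assms] bij_exp_L1] by simp
qed

lemma component_exp_L1:
  assumes M: "\<And>m. m > M \<Longrightarrow> component V (n + int m) v = 0"
  shows "component V n (exp_L1 V x v) =
    (\<Sum>m\<le>M. scl V (x ^ m / fact m) ((Lop V 1 ^^ m) (component V (n + int m) v)))"
proof -
  obtain M' where M': "\<And>m. m \<ge> M' \<Longrightarrow> (Lop V 1 ^^ m) v = 0" using L1_nilpotent[of v] by blast
  define L where "L = Suc M + M'"
  have L: "M' \<le> L" "M < L" by (simp_all add: L_def)
  have "exp_L1 V x v = (\<Sum>m<L. scl V (x ^ m / fact m) ((Lop V 1 ^^ m) v))"
    using M' L by (intro exp_L1_eq_sum) simp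
  then have "component V n (exp_L1 V x v) =
      (\<Sum>m<L. scl V (x ^ m / fact m) ((Lop V 1 ^^ m) (component V (n + int m) v)))"
    by (simp add: component_sum component_scale component_L1_pow)
  also have "\<dots> = (\<Sum>m\<le>M. scl V (x ^ m / fact m) ((Lop V 1 ^^ m) (component V (n + int m) v)))"
    by (rule sum.mono_neutral_right) (use M L in auto)
  finally show ?thesis .
qed

lemma component_Kop_top:
  assumes "v \<in> filt V N"
  shows "component V N (Kop V \<gamma> \<tau> v) = scl V (aut_factor \<gamma> \<tau> powi (- 2 * N)) (component V N v)"
  unfolding Kop_def by (subst component_exp_L1[of 0]) (use assms in \<open>auto simp: component_pow_L0 filt_def\<close>)

text \<open>
One step below the top weight, the linear term of \<open>exp (-c j L(1))\<close> contributes as well.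
\<close>

lemma component_Kop_subtop:
  assumes "v \<in> filt V N"
  shows "component V (N - 1) (Kop V \<gamma> \<tau> v) =
     scl V (aut_factor \<gamma> \<tau> powi (- 2 * (N - 1))) (component V (N - 1) v) -
     scl V (of_real (\<gamma>$2$1) * aut_factor \<gamma> \<tau> * aut_factor \<gamma> \<tau> powi (- 2 * N)) (Lop V 1 (component V N v))"
proof -
  have "component V (N - 1) (Kop V \<gamma> \<tau> v) =
     scl V (aut_factor \<gamma> \<tau> powi (- 2 * (N - 1))) (component V (N - 1) v) +
     scl V (- (of_real (\<gamma>$2$1) * aut_factor \<gamma> \<tau>)) (Lop V 1 (scl V (aut_factor \<gamma> \<tau> powi (- 2 * N)) (component V N v)))"
    unfolding Kop_def by (subst component_exp_L1[of 1]) (use assms in \<open>auto simp: component_pow_L0 filt_def\<close>)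
  then show ?thesis by (simp add: L_scale vs.scale_minus_left)
qed

lemma Kop_QP:
  assumes "v \<in> QP V n"
  shows "Kop V \<gamma> \<tau> (scl V c v) = scl V (aut_factor \<gamma> \<tau> powi (- 2 * n) * c) v"
proof -
  have v: "v \<in> wt V n" "Lop V 1 v = 0" using assms by (auto simp: QP_def)
  have "pow_L0 V (aut_factor \<gamma> \<tau>) (- 2) (scl V c v) = scl V (aut_factor \<gamma> \<tau> powi (- 2 * n) * c) v"
    by (rule component_eqI) (auto simp: component_pow_L0 component_scale component_of_wt[OF v(1)])
  moreover have "(Lop V 1 ^^ m) (scl V d v) = 0" if "m \<ge> 1" for m d
    using that v(2) by (induction m rule: dec_induct) (auto simp: L_scale L_zero)
  then have "exp_L1 V x (scl V d v) = scl V d v" for x d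
    by (subst exp_L1_eq_sum[of 1]) auto
  ultimately show ?thesis by (simp add: Kop_def)
qed

end

section \<open>The leading component\<close>

context quasi_vertex_operator_algebra
begin

lemma modular_form_transformation:
  assumes f: "f \<in> modular_forms V \<Gamma> k" and \<gamma>: "\<gamma> \<in> \<Union>\<Gamma>" "det \<gamma> = 1" and \<tau>: "Im \<tau> > 0"
  shows "f (moebius \<gamma> \<tau>) = Kop V \<gamma> \<tau> (scl V (aut_factor \<gamma> \<tau> powi k) (f \<tau>))"
proof -
  define j where "j = aut_factor \<gamma> \<tau>"
  have j: "j \<noteq> 0" using aut_factor_nonzero[OF \<gamma>(2) \<tau>] by (simp add: j_def)
  have "slash V k f \<gamma> \<tau> = f \<tau>"
    using f \<gamma>(1) \<tau> by (auto simp: modular_forms_def upper_half_plane_def)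
  then have "scl V (j powi k) (f \<tau>) =
      scl V (j powi k * j powi (- k)) (inv_into UNIV (Kop V \<gamma> \<tau>) (f (moebius \<gamma> \<tau>)))"
    by (simp only: slash_def j_def[symmetric] flip: vs.scale_scale)
  also have "\<dots> = inv_into UNIV (Kop V \<gamma> \<tau>) (f (moebius \<gamma> \<tau>))"
    using j by (simp add: power_int_minus)
  finally show ?thesis
    using bij_Kop[of \<gamma> \<tau>] j surj_f_inv_f[of "Kop V \<gamma> \<tau>" "f (moebius \<gamma> \<tau>)"] by (simp add: j_def bij_is_surj)
qed

lemma filt_scale: "v \<in> filt V N \<Longrightarrow> scl V c v \<in> filt V N"
  by (simp add: filt_def component_scale)

lemma top_component_transformation:
  assumes f: "f \<in> modular_forms V \<Gamma> k" and \<gamma>: "\<gamma> \<in> \<Union>\<Gamma>" "det \<gamma> = 1" and \<tau>: "Im \<tau> > 0"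
    and N: "f \<tau> \<in> filt V N"
  shows "component V N (f (moebius \<gamma> \<tau>)) = scl V (aut_factor \<gamma> \<tau> powi (k - 2 * N)) (component V N (f \<tau>))"
proof -
  have "aut_factor \<gamma> \<tau> \<noteq> 0" using aut_factor_nonzero[OF \<gamma>(2) \<tau>] .
  then show ?thesis
    unfolding modular_form_transformation[OF f \<gamma> \<tau>] component_Kop_top[OF filt_scale[OF N]]
    by (simp add: component_scale flip: power_int_add)
qed

lemma subtop_component_transformation:
  assumes f: "f \<in> modular_forms V \<Gamma> (2 * n)" and \<gamma>: "\<gamma> \<in> \<Union>\<Gamma>" "det \<gamma> = 1" and \<tau>: "Im \<tau> > 0"
    and n: "f \<tau> \<in> filt V n"
  shows "component V (n - 1) (f (moebius \<gamma> \<tau>)) =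
    scl V ((aut_factor \<gamma> \<tau>)\<^sup>2) (component V (n - 1) (f \<tau>)) -
    scl V (of_real (\<gamma>$2$1) * aut_factor \<gamma> \<tau>) (Lop V 1 (component V n (f \<tau>)))"
proof -
  define j where "j = aut_factor \<gamma> \<tau>"
  have j: "j \<noteq> 0" using aut_factor_nonzero[OF \<gamma>(2) \<tau>] by (simp add: j_def)
  have 1: "j powi (- 2 * (n - 1)) * j powi (2 * n) = j\<^sup>2"
    using j power_int_add[of j "- 2 * (n - 1)" "2 * n"] by simp
  have 2: "of_real (\<gamma>$2$1) * j * j powi (- 2 * n) * j powi (2 * n) = of_real (\<gamma>$2$1) * j"
    using j power_int_add[of j "- 2 * n" "2 * n"] by (simp add: mult.assoc)
  have L1: "Lop V 1 (scl V c x) = scl V c (Lop V 1 x)" for c x by (simp add: L_scale)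
  show ?thesis
    unfolding modular_form_transformation[OF f \<gamma> \<tau>] component_Kop_subtop[OF filt_scale[OF n]] j_def[symmetric]
    by (simp only: component_scale L1 vs.scale_scale 1 2)
qed

lemma holomorphic_functional_component:
  assumes "f \<in> modular_forms V \<Gamma> k" "Vector_Spaces.linear (scl V) (*) \<phi>"
  shows "(\<lambda>\<tau>. \<phi> (component V N (f \<tau>))) holomorphic_on {\<tau>. Im \<tau> > 0}"
proof -
  have "Vector_Spaces.linear (scl V) (*) (\<phi> \<circ> component V N)"
    by (rule Vector_Spaces.linear_compose[OF component_linear assms(2)])
  then show ?thesis
    using assms(1) unfolding modular_forms_def holomorphic_filt_def upper_half_plane_def by fastforce
qed

lemma functional_scale:
  "Vector_Spaces.linear (scl V) (*) \<phi> \<Longrightarrow> \<phi> (scl V c v) = c * \<phi> v"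
  by (simp add: linear_iff_module_hom module_hom.scale)

lemma functional_diff:
  "Vector_Spaces.linear (scl V) (*) \<phi> \<Longrightarrow> \<phi> (v - w) = \<phi> v - \<phi> w"
  by (simp add: linear_iff_module_hom module_hom.diff)

lemma eq_if_functionals_eq:
  assumes "\<And>\<phi>. Vector_Spaces.linear (scl V) ((*) :: complex \<Rightarrow> _) \<phi> \<Longrightarrow> \<phi> v = \<phi> w"
  shows "v = w"
proof (rule ccontr)
  assume "v \<noteq> w"
  then have "v - w \<noteq> 0" by simp
  then obtain \<phi> where \<phi>: "Vector_Spaces.linear (scl V) ((*) :: complex \<Rightarrow> _) \<phi>" "\<phi> (v - w) = 1"
    by (rule linear_functional_exists)
  show False using assms[OF \<phi>(1)] functional_diff[OF \<phi>(1), of v w] \<phi>(2) by simp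
qed

text \<open>
As long as \<open>f\<close> takes values in \<open>F_N V\<close> with \<open>N > n\<close>, its component of weight \<open>N\<close> is a form of negative weight
\<open>2n - 2N\<close> and vanishes. So \<open>N\<close> can be lowered until it reaches \<open>n\<close>.
\<close>

lemma modular_form_values_in_filt:
  assumes \<Gamma>: "lifted_cocompact_group (\<Union>\<Gamma>)" and f: "f \<in> modular_forms V \<Gamma> (2 * n)" and "Im \<tau> > 0"
  shows "f \<tau> \<in> filt V n"
proof -
  interpret lifted_cocompact_group "\<Union>\<Gamma>" by (rule \<Gamma>)
  obtain N0 where N0: "\<And>\<tau>. Im \<tau> > 0 \<Longrightarrow> f \<tau> \<in> filt V N0"
    using f by (auto simp: modular_forms_def holomorphic_filt_def upper_half_plane_def PiE_def Pi_def)
  have step: "\<forall>\<tau>. Im \<tau> > 0 \<longrightarrow> f \<tau> \<in> filt V (N - 1)"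
    if N: "\<forall>\<tau>. Im \<tau> > 0 \<longrightarrow> f \<tau> \<in> filt V N" and Nn: "N > n" for N
  proof (intro allI impI)
    fix \<tau> assume \<tau>: "Im \<tau> > 0"
    define m where "m = nat (N - n)"
    have m: "m > 0" "int m = N - n" using Nn by (auto simp: m_def)
    have "component V N (f \<tau>) = 0"
    proof (rule eq_if_functionals_eq)
      fix \<phi> assume \<phi>: "Vector_Spaces.linear (scl V) ((*) :: complex \<Rightarrow> _) \<phi>"
      have "\<phi> (component V N (f \<tau>)) = 0"
      proof (rule nonpositive_weight_constant(2)[OF holomorphic_functional_component[OF f \<phi>] _ m(1) \<tau>])
        fix \<gamma> \<tau> assume \<gamma>: "\<gamma> \<in> \<Union>\<Gamma>" and \<tau>: "Im \<tau> > 0"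
        define j where "j = aut_factor \<gamma> \<tau>"
        have j: "j \<noteq> 0" using aut_factor_nonzero[OF det[OF \<gamma>] \<tau>] by (simp add: j_def)
        have "j powi (2 * n - 2 * N) * j ^ (2 * m) = j powi (2 * n - 2 * N) * j powi (2 * (N - n))"
          using m(2) power_int_of_nat[of j "2 * m"] by simp
        also have "\<dots> = 1" using j by (simp flip: power_int_add)
        finally show "\<phi> (component V N (f (moebius \<gamma> \<tau>))) * aut_factor \<gamma> \<tau> ^ (2 * m) = \<phi> (component V N (f \<tau>))"
          using top_component_transformation[OF f \<gamma> det[OF \<gamma>] \<tau>, of N] N \<tau>
          by (simp add: functional_scale[OF \<phi>] j_def[symmetric])
      qed
      then show "\<phi> (component V N (f \<tau>)) = \<phi> 0" using functional_scale[OF \<phi>, of 0 0] by simp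
    qed
    moreover have "component V i (f \<tau>) = 0" if "i > N" for i
      using N \<tau> that by (simp add: filt_def)
    moreover have "i = N \<or> i > N" if "i > N - 1" for i using that by linarith
    ultimately show "f \<tau> \<in> filt V (N - 1)" unfolding filt_def by blast
  qed
  have "\<forall>\<tau>. Im \<tau> > 0 \<longrightarrow> f \<tau> \<in> filt V n"
    if "\<forall>\<tau>. Im \<tau> > 0 \<longrightarrow> f \<tau> \<in> filt V (n + int d)" for d
    using that
  proof (induction d)
    case (Suc d)
    show ?case using Suc.IH step[OF Suc.prems] by simp
  qed simp
  moreover have "f \<tau> \<in> filt V (n + int (nat (N0 - n)))" if "Im \<tau> > 0" for \<tau>
    using N0[OF that] by (auto simp: filt_def)
  ultimately show ?thesis using \<open>Im \<tau> > 0\<close> by blast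
qed

lemma leading_component_constant:
  assumes \<Gamma>: "lifted_cocompact_group (\<Union>\<Gamma>)" and f: "f \<in> modular_forms V \<Gamma> (2 * n)"
    and \<tau>: "Im \<tau> > 0" and \<sigma>: "Im \<sigma> > 0"
  shows "component V n (f \<tau>) = component V n (f \<sigma>)"
proof (rule eq_if_functionals_eq)
  interpret lifted_cocompact_group "\<Union>\<Gamma>" by (rule \<Gamma>)
  fix \<phi> assume \<phi>: "Vector_Spaces.linear (scl V) ((*) :: complex \<Rightarrow> _) \<phi>"
  have "(\<lambda>\<tau>. \<phi> (component V n (f \<tau>))) constant_on {\<tau>. Im \<tau> > 0}"
  proof (rule nonpositive_weight_constant(1)[OF holomorphic_functional_component[OF f \<phi>], where m=0])
    fix \<gamma> \<tau> assume "\<gamma> \<in> \<Union>\<Gamma>" "Im \<tau> > 0"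
    then show "\<phi> (component V n (f (moebius \<gamma> \<tau>))) * aut_factor \<gamma> \<tau> ^ (2 * 0) = \<phi> (component V n (f \<tau>))"
      using top_component_transformation[OF f _ det _ modular_form_values_in_filt[OF \<Gamma> f]] by simp
  qed
  then show "\<phi> (component V n (f \<tau>)) = \<phi> (component V n (f \<sigma>))" using \<tau> \<sigma> by (auto simp: constant_on_def)
qed

text \<open>
A functional that takes the value \<open>1\<close> on \<open>L(1) f_n\<close> would turn the next lower component of \<open>f\<close> into a
holomorphic quasimodular form of weight two.
\<close>

lemma leading_component_quasi_primary:
  assumes \<Gamma>: "lifted_cocompact_group (\<Union>\<Gamma>)" and f: "f \<in> modular_forms V \<Gamma> (2 * n)" and \<tau>: "Im \<tau> > 0"
  shows "component V n (f \<tau>) \<in> QP V n"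
proof -
  interpret lifted_cocompact_group "\<Union>\<Gamma>" by (rule \<Gamma>)
  define w where "w = Lop V 1 (component V n (f \<tau>))"
  have "w = 0"
  proof (rule ccontr)
    assume "w \<noteq> 0"
    then obtain \<phi> where \<phi>: "Vector_Spaces.linear (scl V) ((*) :: complex \<Rightarrow> _) \<phi>" "\<phi> w = 1"
      by (rule linear_functional_exists)
    show False
    proof (rule no_quasimodular_form[OF holomorphic_functional_component[OF f \<phi>(1), of "n - 1"]])
      fix \<gamma> \<sigma> assume \<gamma>: "\<gamma> \<in> \<Union>\<Gamma>" and \<sigma>: "Im \<sigma> > 0"
      have "Lop V 1 (component V n (f \<sigma>)) = w"
        using leading_component_constant[OF \<Gamma> f \<sigma> \<tau>] by (simp add: w_def)
      then show "\<phi> (component V (n - 1) (f (moebius \<gamma> \<sigma>))) =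
          (aut_factor \<gamma> \<sigma>)\<^sup>2 * \<phi> (component V (n - 1) (f \<sigma>)) - of_real (\<gamma>$2$1) * aut_factor \<gamma> \<sigma>"
        by (simp add: subtop_component_transformation[OF f \<gamma> det[OF \<gamma>] \<sigma> modular_form_values_in_filt[OF \<Gamma> f \<sigma>]]
            functional_diff[OF \<phi>(1)] functional_scale[OF \<phi>(1)] \<phi>(2))
    qed
  qed
  then show ?thesis by (simp add: QP_def w_def component_wt)
qed

lemma const_form_modular:
  assumes det: "\<And>\<gamma>. \<gamma> \<in> \<Union>\<Gamma> \<Longrightarrow> det \<gamma> = 1" and v: "v \<in> QP V n"
  shows "const_form v \<in> modular_forms V \<Gamma> (2 * n)"
  unfolding modular_forms_def
proof (intro CollectI conjI exI ballI allI impI)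
  have "v \<in> wt V n" using v by (simp add: QP_def)
  then have "v \<in> filt V n" by (simp add: filt_def component_of_wt)
  then show "holomorphic_filt V n (const_form v)"
    unfolding holomorphic_filt_def const_form_def
    by (auto cong: holomorphic_cong)
  have j: "aut_factor \<gamma> \<tau> \<noteq> 0" if "\<gamma> \<in> \<Union>\<Gamma>" "\<tau> \<in> upper_half_plane" for \<gamma> \<tau>
    using aut_factor_nonzero[OF det[OF that(1)]] that(2) by (simp add: upper_half_plane_def)
  show "slash V (2 * n) (const_form v) \<gamma> \<tau> = const_form v \<tau>" if \<gamma>\<tau>: "\<gamma> \<in> \<Union>\<Gamma>" "\<tau> \<in> upper_half_plane" for \<gamma> \<tau>
  proof -
    define j where "j = aut_factor \<gamma> \<tau>"
    have j0: "j \<noteq> 0" using j[OF \<gamma>\<tau>] by (simp add: j_def)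
    have jj: "j powi (- 2 * n) * j powi (2 * n) = 1" using j0 power_int_add[of j "- 2 * n" "2 * n"] by simp
    have m: "moebius \<gamma> \<tau> \<in> upper_half_plane"
      using Im_moebius_pos[OF det[OF \<gamma>\<tau>(1)]] \<gamma>\<tau>(2) by (simp add: upper_half_plane_def)
    have "Kop V \<gamma> \<tau> (scl V (j powi (2 * n)) v) = v"
      using jj by (simp add: Kop_QP[OF v] j_def)
    then have "inv_into UNIV (Kop V \<gamma> \<tau>) v = scl V (j powi (2 * n)) v"
      using bij_Kop[OF j[OF \<gamma>\<tau>]] by (metis bij_is_inj inv_f_f)
    then show ?thesis
      using m \<gamma>\<tau>(2) jj by (simp add: slash_def const_form_def j_def[symmetric])
  qed
  show "scl V (aut_factor \<gamma> \<tau> powi (2 * n)) (Kop V \<gamma> \<tau> (const_form v \<tau>)) = const_form v \<tau>"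
    if "elliptic_point \<Gamma> \<tau>" "x \<in> stabilizer_PSL \<Gamma> \<tau>" "\<gamma> \<in> x" for \<tau> x \<gamma>
  proof -
    have \<tau>: "\<tau> \<in> upper_half_plane" using that(1) by (simp add: elliptic_point_def)
    have "\<gamma> \<in> \<Union>\<Gamma>" using that by (auto simp: stabilizer_PSL_def)
    then have "aut_factor \<gamma> \<tau> powi (2 * n) * aut_factor \<gamma> \<tau> powi (- 2 * n) = 1"
      using j \<tau> power_int_add[of "aut_factor \<gamma> \<tau>" "2 * n" "- 2 * n"] by simp
    then show ?thesis using \<tau> Kop_QP[OF v, of \<gamma> \<tau> 1] by (simp add: const_form_def)
  qed
qed

end

theorem proposition8p3:
  fixes V :: "('v::ab_group_add) qvoa_data" and \<Gamma> :: "(real^2^2) set set" and k n :: int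
  assumes "quasi_vertex_operator_algebra V"
    and "cocompact_fuchsian \<Gamma>"
    and "k = 2 * n" and "k \<ge> 2"
  shows "component_map V n ` modular_forms V \<Gamma> k = const_form ` QP V n"
proof -
  interpret quasi_vertex_operator_algebra V by (rule assms(1))
  have \<Gamma>: "lifted_cocompact_group (\<Union>\<Gamma>)" by (rule cocompact_fuchsian_imp_lifted[OF assms(2)])
  show ?thesis
  proof (intro equalityI subsetI)
    fix h assume "h \<in> component_map V n ` modular_forms V \<Gamma> k"
    then obtain f where f: "f \<in> modular_forms V \<Gamma> (2 * n)" "h = component_map V n f"
      using assms(3) by auto
    define v where "v = component V n (f \<i>)"
    have "component V n (f \<tau>) = v" if "\<tau> \<in> upper_half_plane" for \<tau>
      using leading_component_constant[OF \<Gamma> f(1), of \<tau> \<i>] that by (simp add: v_def upper_half_plane_def)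
    then have "h = const_form v"
      unfolding f(2) component_map_def const_form_def by (intro restrict_ext)
    moreover have "v \<in> QP V n"
      unfolding v_def by (rule leading_component_quasi_primary[OF \<Gamma> f(1)]) simp
    ultimately show "h \<in> const_form ` QP V n" by blast
  next
    fix h assume "h \<in> const_form ` QP V n"
    then obtain v where v: "v \<in> QP V n" "h = const_form v" by blast
    have "const_form v \<in> modular_forms V \<Gamma> k"
      unfolding assms(3) by (rule const_form_modular[OF lifted_cocompact_group.det[OF \<Gamma>] v(1)])
    moreover have "component_map V n (const_form v) = const_form v"
      using v(1) unfolding component_map_def const_form_def
      by (intro restrict_ext) (simp add: QP_def component_of_wt[of v n n])
    ultimately show "h \<in> component_map V n ` modular_forms V \<Gamma> k" using v(2) by (metis image_eqI)
  qed
qed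

end
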